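(* Let $R$ be an algebra over a commutative ring $\mathbb K$ and let $\mathcal B=(B,\xi,\zeta,\Delta,\epsilon)$ be a left bialgebroid over $R$. Let $C$ be a left $\mathcal B$-comodule coring with coaction $c\mapsto c_{[-1]}\otimes_Rc_{[0]}$, and let $X$ be a left $\mathcal B$-module with action $\triangleright$. Then $$w:C\otimes_RX\to X\otimes_RC,\qquad w(c\otimes_Rx):=c_{[-1]}\triangleright x\otimes_Rc_{[0]}$$ is a (dual) transposition map for the $R$-coring $C$. Hence the simplicial $\mathbb K$-module $C^{\widehat\otimes_R\,\ast+1}\widehat\otimes_RX$ admits a para-cyclic structure $$w_n(c_0\widehat\otimes_R\dots\widehat\otimes_Rc_n\widehat\otimes_Rx)=c_{n[0]}\widehat\otimes_Rc_0\widehat\otimes_R\dots\widehat\otimes_Rc_{n-1}\widehat\otimes_R(c_{n[-1]}\triangleright x).$$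
   Context: All algebras are associative and unital; implicit summation is used in index notations. An $R$-coring is a coalgebra in the monoidal category of $R$-bimodules. Left bialgebroid over $R$: data $(B,\xi,\zeta,\Delta,\epsilon)$ with $B$ a $\mathbb K$-algebra, $\xi:R\to B$ and $\zeta:R^{op}\to B$ algebra maps with commuting ranges; $B$ is an $R$-bimodule by $r_1\cdot b\cdot r_2=\xi(r_1)\zeta(r_2)b$; $\Delta:B\to B\otimes_RB$, $b\mapsto b_{(1)}\otimes_Rb_{(2)}$, and $\epsilon:B\to R$ make this bimodule an $R$-coring; and (i) $b_{(1)}\zeta(r)\otimes_Rb_{(2)}=b_{(1)}\otimes_Rb_{(2)}\xi(r)$; (ii) $\Delta(1_B)=1_B\otimes_R1_B$, $\Delta(bb')=b_{(1)}b'_{(1)}\otimes_Rb_{(2)}b'_{(2)}$; (iii) $\epsilon(1_B)=1_R$, $\epsilon(bb')=\epsilon(b\,\xi(\epsilon(b')))$. A left $\mathcal B$-module $V$ is an $R$-bimodule by $r_1\cdot v\cdot r_2=\xi(r_1)\zeta(r_2)\triangleright v$. A left $\mathcal B$-comodule is a left $R$-module $V$ with a left $R$-linear, coassociative and counital coaction $V\to\mathcal B\otimes_RV$, $v\mapsto v_{[-1]}\otimes_Rv_{[0]}$; it is an $R$-bimodule with right action $v\cdot r:=\epsilon(v_{[-1]}\xi(r))\cdot v_{[0]}$. A left $\mathcal B$-comodule coring is an $R$-coring $(C,\Delta_C,\epsilon_C)$, $\Delta_C(c)=c_{(1)}\otimes_Rc_{(2)}$, which is a left $\mathcal B$-comodule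 with the same underlying $R$-bimodule structure, such that $\xi(\epsilon_C(c))=\zeta(\epsilon_C(c_{[0]}))c_{[-1]}$ and $c_{[-1]}\otimes_Rc_{[0](1)}\otimes_Rc_{[0](2)}=c_{(1)[-1]}c_{(2)[-1]}\otimes_Rc_{(1)[0]}\otimes_Rc_{(2)[0]}$ for all $c\in C$. (Dual) transposition map for an $R$-coring $C$ and an $R$-bimodule $X$: an $R$-bimodule map $w:C\otimes_RX\to X\otimes_RC$ with $(X\otimes_R\epsilon_C)\circ w=\epsilon_C\otimes_RX$ and $(X\otimes_R\Delta_C)\circ w=(w\otimes_RC)\circ(C\otimes_Rw)\circ(\Delta_C\otimes_RX)$. Cyclic tensor product: for $R$-bimodules, $X_1\widehat\otimes_R\dots\widehat\otimes_RX_n$ is the quotient $\mathbb K$-module of $Y=X_1\otimes_R\dots\otimes_RX_n$ by the submodule generated by $r\cdot y-y\cdot r$, $r\in R$, $y\in Y$; classes of tensor monomials are written $x_1\widehat\otimes_R\dots\widehat\otimes_Rx_n$. The simplicial $\mathbb K$-module $Z_n=C^{\widehat\otimes_R\,n+1}\widehat\otimes_RX$ has, for $0\le k\le n$, faces $d_k:Z_n\to Z_{n-1}$ applying $\epsilon_C$ to the factor $c_k$ (and absorbing the resulting element of $R$ via the $R$-actions) and degeneracies $s_k:Z_n\to Z_{n+1}$ applying $\Delta_C$ to the factor $c_k$. A para-cyclic structure on a simplicial object consists of morphisms $w_n:Z_n\to Z_n$ with $d_0w_n=d_n$, $d_kw_n=w_{n-1}d_{k-1}$, $s_0w_n=(w_{n+1})^2s_n$,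 $s_kw_n=w_{n+1}s_{k-1}$ for $1\le k\le n$ (relations with faces for $n\ge1$). *)

theory Defs
  imports "HOL-Library.Poly_Mapping"
begin

text \<open>
  Rings have sort \<open>{ring, monoid_mult}\<close> (commutative ones \<open>{comm_ring, comm_monoid_mult}\<close>) and not
  \<open>ring_1\<close>, because \<open>ring_1\<close> contains the axiom \<open>0 \<noteq> 1\<close> and so excludes the zero ring.  For the same
  reason \<open>module\<close> from the library, whose scalars form a \<open>comm_ring_1\<close>, is not used.
\<close>

locale k_module =
  fixes s :: "'k::{comm_ring, comm_monoid_mult} \<Rightarrow> 'm::ab_group_add \<Rightarrow> 'm"
  assumes scale_add_right: "s k (m + m') = s k m + s k m'"
    and scale_add_left: "s (k + l) m = s k m + s l m"
    and scale_scale: "s k (s l m) = s (k * l) m"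
    and scale_one: "s 1 m = m"

locale k_algebra = k_module s
  for s :: "'k::{comm_ring, comm_monoid_mult} \<Rightarrow> 'a::{ring, monoid_mult} \<Rightarrow> 'a" +
  assumes scale_mult_left: "s k (a * b) = s k a * b"
    and scale_mult_right: "s k (a * b) = a * s k b"

definition k_linear ::
  "('k \<Rightarrow> 'm::ab_group_add \<Rightarrow> 'm) \<Rightarrow> ('k \<Rightarrow> 'n::ab_group_add \<Rightarrow> 'n) \<Rightarrow> ('m \<Rightarrow> 'n) \<Rightarrow> bool" where
  "k_linear s t f \<longleftrightarrow> (\<forall>m m'. f (m + m') = f m + f m') \<and> (\<forall>k m. f (s k m) = t k (f m))"

record ('k, 'r, 'm) lmod =
  scale :: "'k \<Rightarrow> 'm \<Rightarrow> 'm"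
  lact :: "'r \<Rightarrow> 'm \<Rightarrow> 'm"

record ('k, 'r, 'm) bimod = "('k, 'r, 'm) lmod" +
  ract :: "'m \<Rightarrow> 'r \<Rightarrow> 'm"

locale left_module = k_algebra sA + k_module "scale V"
  for sA :: "'k::{comm_ring, comm_monoid_mult} \<Rightarrow> 'a::{ring, monoid_mult} \<Rightarrow> 'a"
    and V :: "('k, 'a, 'v::ab_group_add, 'z) lmod_scheme" +
  assumes lact_linear: "k_linear (scale V) (scale V) (lact V a)"
    and lact_linear_ring: "k_linear sA (scale V) (\<lambda>a. lact V a v)"
    and lact_mult: "lact V (a * b) v = lact V a (lact V b v)"
    and lact_one: "lact V 1 v = v"

locale bimodule = left_module sR M
  for sR :: "'k::{comm_ring, comm_monoid_mult} \<Rightarrow> 'r::{ring, monoid_mult} \<Rightarrow> 'r"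
    and M :: "('k, 'r, 'm::ab_group_add, 'z) bimod_scheme" +
  assumes ract_linear: "k_linear (scale M) (scale M) (\<lambda>m. ract M m r)"
    and ract_linear_ring: "k_linear sR (scale M) (ract M m)"
    and ract_mult: "ract M m (r * r') = ract M (ract M m r) r'"
    and ract_one: "ract M m 1 = m"
    and lact_ract: "lact M r (ract M m r') = ract M (lact M r m) r'"


section \<open>Modules given by generators and relations\<close>

text \<open>
  All tensor products are quotients of free \<open>'k\<close>-modules.  The free module on the words of type
  \<open>'w\<close> is the type \<open>'w \<Rightarrow>\<^sub>0 'k\<close>, and an element of a quotient is a coset, of type \<open>('w \<Rightarrow>\<^sub>0 'k) set\<close>.
\<close>

definition fscale :: "'k::{comm_ring, comm_monoid_mult} \<Rightarrow> ('w \<Rightarrow>\<^sub>0 'k) \<Rightarrow> ('w \<Rightarrow>\<^sub>0 'k)" where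
  "fscale k p = Poly_Mapping.map ((*) k) p"

definition monom :: "'w \<Rightarrow> ('w \<Rightarrow>\<^sub>0 'k::{comm_ring, comm_monoid_mult})" where
  "monom w = Poly_Mapping.single w 1"

text \<open>The linear extension of a map on words, into the module with scalar multiplication \<open>s\<close>.\<close>

definition linext ::
  "('k::{comm_ring, comm_monoid_mult} \<Rightarrow> 'm::ab_group_add \<Rightarrow> 'm) \<Rightarrow> ('w \<Rightarrow> 'm) \<Rightarrow> ('w \<Rightarrow>\<^sub>0 'k) \<Rightarrow> 'm"
where
  "linext s f p = (\<Sum>w \<in> Poly_Mapping.keys p. s (Poly_Mapping.lookup p w) (f w))"

definition push ::
  "('w \<Rightarrow> 'v) \<Rightarrow> ('w \<Rightarrow>\<^sub>0 'k::{comm_ring, comm_monoid_mult}) \<Rightarrow> ('v \<Rightarrow>\<^sub>0 'k)" where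
  "push f = linext fscale (\<lambda>w. monom (f w))"

inductive_set fspan ::
  "('w \<Rightarrow>\<^sub>0 'k::{comm_ring, comm_monoid_mult}) set \<Rightarrow> ('w \<Rightarrow>\<^sub>0 'k) set"
  for A :: "('w \<Rightarrow>\<^sub>0 'k) set" where
  fspan_zero: "0 \<in> fspan A"
| fspan_base: "p \<in> A \<Longrightarrow> p \<in> fspan A"
| fspan_add: "p \<in> fspan A \<Longrightarrow> q \<in> fspan A \<Longrightarrow> p + q \<in> fspan A"
| fspan_scale: "p \<in> fspan A \<Longrightarrow> fscale k p \<in> fspan A"

record (overloaded) ('w, 'k) presentation =
  gens :: "'w set"
  rels :: "('w \<Rightarrow>\<^sub>0 'k) set"

definition coset ::
  "('w, 'k::{comm_ring, comm_monoid_mult}) presentation \<Rightarrow> ('w \<Rightarrow>\<^sub>0 'k) \<Rightarrow> ('w \<Rightarrow>\<^sub>0 'k) set" where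
  "coset P p = {q. q - p \<in> fspan (rels P)}"

definition pcarrier ::
  "('w, 'k::{comm_ring, comm_monoid_mult}) presentation \<Rightarrow> ('w \<Rightarrow>\<^sub>0 'k) set set" where
  "pcarrier P = {coset P p |p. Poly_Mapping.keys p \<subseteq> gens P}"

definition gen ::
  "('w, 'k::{comm_ring, comm_monoid_mult}) presentation \<Rightarrow> 'w \<Rightarrow> ('w \<Rightarrow>\<^sub>0 'k) set" where
  "gen P w = coset P (monom w)"

definition rep :: "('w \<Rightarrow>\<^sub>0 'k::zero) set \<Rightarrow> ('w \<Rightarrow>\<^sub>0 'k)" where
  "rep t = (SOME p. p \<in> t)"

definition padd ::
  "('w, 'k::{comm_ring, comm_monoid_mult}) presentation
    \<Rightarrow> ('w \<Rightarrow>\<^sub>0 'k) set \<Rightarrow> ('w \<Rightarrow>\<^sub>0 'k) set \<Rightarrow> ('w \<Rightarrow>\<^sub>0 'k) set" where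
  "padd P t u = coset P (rep t + rep u)"

definition pscale ::
  "('w, 'k::{comm_ring, comm_monoid_mult}) presentation
    \<Rightarrow> 'k \<Rightarrow> ('w \<Rightarrow>\<^sub>0 'k) set \<Rightarrow> ('w \<Rightarrow>\<^sub>0 'k) set" where
  "pscale P k t = coset P (fscale k (rep t))"

definition phom ::
  "('w, 'k::{comm_ring, comm_monoid_mult}) presentation \<Rightarrow> ('v, 'k) presentation
    \<Rightarrow> (('w \<Rightarrow>\<^sub>0 'k) set \<Rightarrow> ('v \<Rightarrow>\<^sub>0 'k) set) \<Rightarrow> bool" where
  "phom P Q F \<longleftrightarrow>
     (\<forall>t \<in> pcarrier P. F t \<in> pcarrier Q) \<and>
     (\<forall>t \<in> pcarrier P. \<forall>u \<in> pcarrier P. F (padd P t u) = padd Q (F t) (F u)) \<and>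
     (\<forall>k. \<forall>t \<in> pcarrier P. F (pscale P k t) = pscale Q k (F t))"

definition linear_into ::
  "('k::{comm_ring, comm_monoid_mult} \<Rightarrow> 'm::ab_group_add \<Rightarrow> 'm) \<Rightarrow> ('w, 'k) presentation
    \<Rightarrow> ('m \<Rightarrow> ('w \<Rightarrow>\<^sub>0 'k) set) \<Rightarrow> bool" where
  "linear_into s Q f \<longleftrightarrow>
     (\<forall>m. f m \<in> pcarrier Q) \<and>
     (\<forall>m m'. f (m + m') = padd Q (f m) (f m')) \<and>
     (\<forall>k m. f (s k m) = pscale Q k (f m))"

text \<open>
  Sweedler sums.  If \<open>t\<close> is the class of \<open>\<Sum>\<^sub>i k\<^sub>i w\<^sub>i\<close>, then \<open>msum s t f\<close> and \<open>psum Q t f\<close> denote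
  \<open>\<Sum>\<^sub>i k\<^sub>i f(w\<^sub>i)\<close>, computed in the module with scalar multiplication \<open>s\<close> and in the presented
  module \<open>Q\<close>, respectively.  For instance \<open>psum Q (\<Delta> c) (\<lambda>(c1, c2). gen Q (c2, c1, x))\<close> is
  \<open>c\<^sub>(\<^sub>2\<^sub>) \<otimes> c\<^sub>(\<^sub>1\<^sub>) \<otimes> x\<close>.  The sum is evaluated on one chosen representative of \<open>t\<close>; as always with
  Sweedler notation, this is meaningful because the complete expression it occurs in
  does not depend on the choice.
\<close>

definition msum ::
  "('k::{comm_ring, comm_monoid_mult} \<Rightarrow> 'm::ab_group_add \<Rightarrow> 'm)
    \<Rightarrow> ('w \<Rightarrow>\<^sub>0 'k) set \<Rightarrow> ('w \<Rightarrow> 'm) \<Rightarrow> 'm" where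
  "msum s t f = linext s f (rep t)"

definition psum ::
  "('v, 'k::{comm_ring, comm_monoid_mult}) presentation
    \<Rightarrow> ('w \<Rightarrow>\<^sub>0 'k) set \<Rightarrow> ('w \<Rightarrow> ('v \<Rightarrow>\<^sub>0 'k) set) \<Rightarrow> ('v \<Rightarrow>\<^sub>0 'k) set" where
  "psum Q t f = coset Q (linext fscale (\<lambda>w. rep (f w)) (rep t))"


section \<open>Tensor products over \<open>R\<close>\<close>

definition tensor_rels ::
  "('k::{comm_ring, comm_monoid_mult}, 'r, 'm::ab_group_add, 'y) bimod_scheme
    \<Rightarrow> ('k, 'r, 'n::ab_group_add, 'z) lmod_scheme \<Rightarrow> ('m \<times> 'n \<Rightarrow>\<^sub>0 'k) set" where
  "tensor_rels M N =
     {monom (m + m', n) - monom (m, n) - monom (m', n) |m m' n. True} \<union>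
     {monom (m, n + n') - monom (m, n) - monom (m, n') |m n n'. True} \<union>
     {monom (scale M k m, n) - fscale k (monom (m, n)) |k m n. True} \<union>
     {monom (m, scale N k n) - fscale k (monom (m, n)) |k m n. True} \<union>
     {monom (ract M m r, n) - monom (m, lact N r n) |m r n. True}"

definition tensor2 ::
  "('k::{comm_ring, comm_monoid_mult}, 'r, 'm::ab_group_add, 'y) bimod_scheme
    \<Rightarrow> ('k, 'r, 'n::ab_group_add, 'z) lmod_scheme \<Rightarrow> ('m \<times> 'n, 'k) presentation" where
  "tensor2 M N = \<lparr>gens = UNIV, rels = tensor_rels M N\<rparr>"

text \<open>
  \<open>M \<otimes> N \<otimes> P\<close> is presented on triples, by the relations of \<open>M \<otimes> N\<close> (with any fixed last entry)
  and those of \<open>N \<otimes> P\<close> (with any fixed first entry).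
\<close>

definition tensor3 ::
  "('k::{comm_ring, comm_monoid_mult}, 'r, 'm::ab_group_add, 'x) bimod_scheme
    \<Rightarrow> ('k, 'r, 'n::ab_group_add, 'y) bimod_scheme
    \<Rightarrow> ('k, 'r, 'p::ab_group_add, 'z) lmod_scheme \<Rightarrow> ('m \<times> 'n \<times> 'p, 'k) presentation" where
  "tensor3 M N P =
     \<lparr>gens = UNIV,
      rels = {push (\<lambda>(m, n). (m, n, p)) \<rho> |\<rho> p. \<rho> \<in> tensor_rels M N} \<union>
             {push (\<lambda>(n, p). (m, n, p)) \<rho> |\<rho> m. \<rho> \<in> tensor_rels N P}\<rparr>"

definition tensor_lact ::
  "('k::{comm_ring, comm_monoid_mult}, 'r, 'm::ab_group_add, 'y) bimod_scheme
    \<Rightarrow> ('k, 'r, 'n::ab_group_add, 'z) lmod_scheme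
    \<Rightarrow> 'r \<Rightarrow> ('m \<times> 'n \<Rightarrow>\<^sub>0 'k) set \<Rightarrow> ('m \<times> 'n \<Rightarrow>\<^sub>0 'k) set" where
  "tensor_lact M N r t =
     psum (tensor2 M N) t (\<lambda>(m, n). gen (tensor2 M N) (lact M r m, n))"

definition tensor_ract ::
  "('k::{comm_ring, comm_monoid_mult}, 'r, 'm::ab_group_add, 'y) bimod_scheme
    \<Rightarrow> ('k, 'r, 'n::ab_group_add, 'z) bimod_scheme
    \<Rightarrow> ('m \<times> 'n \<Rightarrow>\<^sub>0 'k) set \<Rightarrow> 'r \<Rightarrow> ('m \<times> 'n \<Rightarrow>\<^sub>0 'k) set" where
  "tensor_ract M N t r =
     psum (tensor2 M N) t (\<lambda>(m, n). gen (tensor2 M N) (m, ract N n r))"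


section \<open>Corings, bialgebroids, comodule corings\<close>

locale coring = bimodule sR C
  for sR :: "'k::{comm_ring, comm_monoid_mult} \<Rightarrow> 'r::{ring, monoid_mult} \<Rightarrow> 'r"
    and C :: "('k, 'r, 'c::ab_group_add, 'z) bimod_scheme"
    and \<Delta> :: "'c \<Rightarrow> ('c \<times> 'c \<Rightarrow>\<^sub>0 'k) set"
    and \<epsilon> :: "'c \<Rightarrow> 'r" +
  assumes comult_linear: "linear_into (scale C) (tensor2 C C) \<Delta>"
    and comult_lact: "\<Delta> (lact C r c) = tensor_lact C C r (\<Delta> c)"
    and comult_ract: "\<Delta> (ract C c r) = tensor_ract C C (\<Delta> c) r"
    and counit_linear: "k_linear (scale C) sR \<epsilon>"
    and counit_lact: "\<epsilon> (lact C r c) = r * \<epsilon> c"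
    and counit_ract: "\<epsilon> (ract C c r) = \<epsilon> c * r"
    and coassoc:
      "psum (tensor3 C C C) (\<Delta> c) (\<lambda>(c1, c2).
         psum (tensor3 C C C) (\<Delta> c1) (\<lambda>(c11, c12). gen (tensor3 C C C) (c11, c12, c2))) =
       psum (tensor3 C C C) (\<Delta> c) (\<lambda>(c1, c2).
         psum (tensor3 C C C) (\<Delta> c2) (\<lambda>(c21, c22). gen (tensor3 C C C) (c1, c21, c22)))"
    and counit_left: "msum (scale C) (\<Delta> c) (\<lambda>(c1, c2). lact C (\<epsilon> c1) c2) = c"
    and counit_right: "msum (scale C) (\<Delta> c) (\<lambda>(c1, c2). ract C c1 (\<epsilon> c2)) = c"

definition bimod_along ::
  "('r \<Rightarrow> 'b) \<Rightarrow> ('r \<Rightarrow> 'b) \<Rightarrow> ('k, 'b, 'v) lmod \<Rightarrow> ('k, 'r, 'v) bimod" where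
  "bimod_along \<xi> \<zeta> V =
     \<lparr>scale = scale V, lact = (\<lambda>r v. lact V (\<xi> r) v), ract = (\<lambda>v r. lact V (\<zeta> r) v)\<rparr>"

text \<open>\<open>B\<close> itself as an \<open>R\<close>-bimodule: \<open>r \<cdot> b \<cdot> r' = \<xi>(r) \<zeta>(r') b\<close>.\<close>

definition base_bimod ::
  "('k \<Rightarrow> 'b \<Rightarrow> 'b) \<Rightarrow> ('r \<Rightarrow> 'b::{ring, monoid_mult}) \<Rightarrow> ('r \<Rightarrow> 'b) \<Rightarrow> ('k, 'r, 'b) bimod" where
  "base_bimod sB \<xi> \<zeta> = bimod_along \<xi> \<zeta> \<lparr>scale = sB, lact = (*)\<rparr>"

locale left_bialgebroid =
  algR: k_algebra sR + algB: k_algebra sB + B: coring sR "base_bimod sB \<xi> \<zeta>" \<Delta> \<epsilon>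
  for sR :: "'k::{comm_ring, comm_monoid_mult} \<Rightarrow> 'r::{ring, monoid_mult} \<Rightarrow> 'r"
    and sB :: "'k \<Rightarrow> 'b::{ring, monoid_mult} \<Rightarrow> 'b"
    and \<xi> :: "'r \<Rightarrow> 'b"
    and \<zeta> :: "'r \<Rightarrow> 'b"
    and \<Delta> :: "'b \<Rightarrow> ('b \<times> 'b \<Rightarrow>\<^sub>0 'k) set"
    and \<epsilon> :: "'b \<Rightarrow> 'r" +
  assumes source_linear: "k_linear sR sB \<xi>"
    and source_mult: "\<xi> (r * r') = \<xi> r * \<xi> r'"
    and source_one: "\<xi> 1 = 1"
    and target_linear: "k_linear sR sB \<zeta>"
    and target_mult: "\<zeta> (r * r') = \<zeta> r' * \<zeta> r"
    and target_one: "\<zeta> 1 = 1"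
    and source_target_commute: "\<xi> r * \<zeta> r' = \<zeta> r' * \<xi> r"
    and takeuchi:
      "psum (tensor2 (base_bimod sB \<xi> \<zeta>) (base_bimod sB \<xi> \<zeta>)) (\<Delta> b)
         (\<lambda>(b1, b2). gen (tensor2 (base_bimod sB \<xi> \<zeta>) (base_bimod sB \<xi> \<zeta>)) (b1 * \<zeta> r, b2)) =
       psum (tensor2 (base_bimod sB \<xi> \<zeta>) (base_bimod sB \<xi> \<zeta>)) (\<Delta> b)
         (\<lambda>(b1, b2). gen (tensor2 (base_bimod sB \<xi> \<zeta>) (base_bimod sB \<xi> \<zeta>)) (b1, b2 * \<xi> r))"
    and comult_one:
      "\<Delta> 1 = gen (tensor2 (base_bimod sB \<xi> \<zeta>) (base_bimod sB \<xi> \<zeta>)) (1, 1)"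
    and comult_mult:
      "\<Delta> (b * b') =
         psum (tensor2 (base_bimod sB \<xi> \<zeta>) (base_bimod sB \<xi> \<zeta>)) (\<Delta> b) (\<lambda>(b1, b2).
           psum (tensor2 (base_bimod sB \<xi> \<zeta>) (base_bimod sB \<xi> \<zeta>)) (\<Delta> b') (\<lambda>(b1', b2').
             gen (tensor2 (base_bimod sB \<xi> \<zeta>) (base_bimod sB \<xi> \<zeta>)) (b1 * b1', b2 * b2')))"
    and counit_one: "\<epsilon> 1 = 1"
    and counit_mult: "\<epsilon> (b * b') = \<epsilon> (b * \<xi> (\<epsilon> b'))"

locale left_comodule = left_bialgebroid sR sB \<xi> \<zeta> \<Delta> \<epsilon> + V: left_module sR V
  for sR :: "'k::{comm_ring, comm_monoid_mult} \<Rightarrow> 'r::{ring, monoid_mult} \<Rightarrow> 'r"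
    and sB :: "'k \<Rightarrow> 'b::{ring, monoid_mult} \<Rightarrow> 'b"
    and \<xi> \<zeta> \<Delta> \<epsilon>
    and V :: "('k, 'r, 'v::ab_group_add, 'z) lmod_scheme"
    and \<rho> :: "'v \<Rightarrow> ('b \<times> 'v \<Rightarrow>\<^sub>0 'k) set" +
  assumes coaction_linear: "linear_into (scale V) (tensor2 (base_bimod sB \<xi> \<zeta>) V) \<rho>"
    and coaction_lact: "\<rho> (lact V r v) = tensor_lact (base_bimod sB \<xi> \<zeta>) V r (\<rho> v)"
    and coaction_coassoc:
      "psum (tensor3 (base_bimod sB \<xi> \<zeta>) (base_bimod sB \<xi> \<zeta>) V) (\<rho> v) (\<lambda>(b, v0).
         psum (tensor3 (base_bimod sB \<xi> \<zeta>) (base_bimod sB \<xi> \<zeta>) V) (\<Delta> b) (\<lambda>(b1, b2).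
           gen (tensor3 (base_bimod sB \<xi> \<zeta>) (base_bimod sB \<xi> \<zeta>) V) (b1, b2, v0))) =
       psum (tensor3 (base_bimod sB \<xi> \<zeta>) (base_bimod sB \<xi> \<zeta>) V) (\<rho> v) (\<lambda>(b, v0).
         psum (tensor3 (base_bimod sB \<xi> \<zeta>) (base_bimod sB \<xi> \<zeta>) V) (\<rho> v0) (\<lambda>(b', v').
           gen (tensor3 (base_bimod sB \<xi> \<zeta>) (base_bimod sB \<xi> \<zeta>) V) (b, b', v')))"
    and coaction_counit: "msum (scale V) (\<rho> v) (\<lambda>(b, v0). lact V (\<epsilon> b) v0) = v"

locale left_comodule_coring =
  left_comodule sR sB \<xi> \<zeta> \<Delta> \<epsilon> C \<rho> + C: coring sR C \<Delta>C \<epsilon>C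
  for sR :: "'k::{comm_ring, comm_monoid_mult} \<Rightarrow> 'r::{ring, monoid_mult} \<Rightarrow> 'r"
    and sB :: "'k \<Rightarrow> 'b::{ring, monoid_mult} \<Rightarrow> 'b"
    and \<xi> \<zeta> \<Delta> \<epsilon>
    and C :: "('k, 'r, 'c::ab_group_add) bimod"
    and \<Delta>C \<epsilon>C \<rho> +
  assumes comodule_ract:
      "ract C c r = msum (scale C) (\<rho> c) (\<lambda>(b, c'). lact C (\<epsilon> (b * \<xi> r)) c')"
    and comodule_counit: "\<xi> (\<epsilon>C c) = msum sB (\<rho> c) (\<lambda>(b, c'). \<zeta> (\<epsilon>C c') * b)"
    and comodule_comult:
      "psum (tensor3 (base_bimod sB \<xi> \<zeta>) C C) (\<rho> c) (\<lambda>(b, c').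
         psum (tensor3 (base_bimod sB \<xi> \<zeta>) C C) (\<Delta>C c') (\<lambda>(c1, c2).
           gen (tensor3 (base_bimod sB \<xi> \<zeta>) C C) (b, c1, c2))) =
       psum (tensor3 (base_bimod sB \<xi> \<zeta>) C C) (\<Delta>C c) (\<lambda>(c1, c2).
         psum (tensor3 (base_bimod sB \<xi> \<zeta>) C C) (\<rho> c1) (\<lambda>(b1, c1').
           psum (tensor3 (base_bimod sB \<xi> \<zeta>) C C) (\<rho> c2) (\<lambda>(b2, c2').
             gen (tensor3 (base_bimod sB \<xi> \<zeta>) C C) (b1 * b2, c1', c2'))))"


section \<open>Transposition maps\<close>

text \<open>
  The two sides of the first compatibility condition are compared in \<open>X\<close>, via the canonical
  isomorphisms \<open>X \<otimes> R \<cong> X \<cong> R \<otimes> X\<close>.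
\<close>

definition transposition_map ::
  "('k::{comm_ring, comm_monoid_mult}, 'r, 'c::ab_group_add) bimod
    \<Rightarrow> ('c \<Rightarrow> ('c \<times> 'c \<Rightarrow>\<^sub>0 'k) set) \<Rightarrow> ('c \<Rightarrow> 'r)
    \<Rightarrow> ('k, 'r, 'x::ab_group_add) bimod
    \<Rightarrow> (('c \<times> 'x \<Rightarrow>\<^sub>0 'k) set \<Rightarrow> ('x \<times> 'c \<Rightarrow>\<^sub>0 'k) set) \<Rightarrow> bool" where
  "transposition_map C \<Delta> \<epsilon> X w \<longleftrightarrow>
     phom (tensor2 C X) (tensor2 X C) w \<and>
     (\<forall>r. \<forall>t \<in> pcarrier (tensor2 C X). w (tensor_lact C X r t) = tensor_lact X C r (w t)) \<and>
     (\<forall>r. \<forall>t \<in> pcarrier (tensor2 C X). w (tensor_ract C X t r) = tensor_ract X C (w t) r) \<and>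
     (\<forall>t \<in> pcarrier (tensor2 C X).
        msum (scale X) (w t) (\<lambda>(x, c). ract X x (\<epsilon> c)) =
        msum (scale X) t (\<lambda>(c, x). lact X (\<epsilon> c) x)) \<and>
     (\<forall>t \<in> pcarrier (tensor2 C X).
        psum (tensor3 X C C) (w t) (\<lambda>(x, c).
          psum (tensor3 X C C) (\<Delta> c) (\<lambda>(c1, c2). gen (tensor3 X C C) (x, c1, c2))) =
        (let \<Delta>X = (\<lambda>u. psum (tensor3 C C X) u (\<lambda>(c, x).
                     psum (tensor3 C C X) (\<Delta> c) (\<lambda>(c1, c2). gen (tensor3 C C X) (c1, c2, x))));
             Cw = (\<lambda>u. psum (tensor3 C X C) u (\<lambda>(c, c', x).
                     psum (tensor3 C X C) (w (gen (tensor2 C X) (c', x))) (\<lambda>(x', c'').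
                       gen (tensor3 C X C) (c, x', c''))));
             wC = (\<lambda>u. psum (tensor3 X C C) u (\<lambda>(c, x, c').
                     psum (tensor3 X C C) (w (gen (tensor2 C X) (c, x))) (\<lambda>(x', c'').
                       gen (tensor3 X C C) (x', c'', c'))))
         in wC (Cw (\<Delta>X t))))"


section \<open>The simplicial module \<open>Z\<^sub>n\<close>\<close>

text \<open>
  A word \<open>([c\<^sub>0, \<dots>, c\<^sub>n], x)\<close> stands for \<open>c\<^sub>0 \<otimes> \<dots> \<otimes> c\<^sub>n \<otimes> x\<close>.  The first two sets of relations in
  \<open>cyclic_tensor\<close> present \<open>Y = C \<otimes> \<dots> \<otimes> C \<otimes> X\<close>; the last one divides by all \<open>r \<cdot> y - y \<cdot> r\<close>, where it is
  enough to let \<open>y\<close> run through the tensor monomials, as these expressions are linear in \<open>y\<close>.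
\<close>

definition cyclic_tensor ::
  "('k::{comm_ring, comm_monoid_mult}, 'r, 'c::ab_group_add) bimod
    \<Rightarrow> ('k, 'r, 'x::ab_group_add) bimod \<Rightarrow> nat \<Rightarrow> ('c list \<times> 'x, 'k) presentation" where
  "cyclic_tensor C X n =
     \<lparr>gens = {(cs, x). length cs = n + 1},
      rels =
        {push (\<lambda>(c, c'). (as @ [c, c'] @ bs, x)) \<rho> |as bs x \<rho>.
           length as + length bs + 1 = n \<and> \<rho> \<in> tensor_rels C C} \<union>
        {push (\<lambda>(c, x). (as @ [c], x)) \<rho> |as \<rho>. length as = n \<and> \<rho> \<in> tensor_rels C X} \<union>
        {monom (lact C r c # cs, x) - monom (c # cs, ract X x r) |r c cs x. length cs = n}\<rparr>"

text \<open>\<open>\<epsilon>(c\<^sub>k)\<close> is absorbed by the left action on the next factor.\<close>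

definition face_word ::
  "('k, 'r, 'c) bimod \<Rightarrow> ('c \<Rightarrow> 'r) \<Rightarrow> ('k, 'r, 'x) bimod \<Rightarrow> nat \<Rightarrow> 'c list \<times> 'x \<Rightarrow> 'c list \<times> 'x"
where
  "face_word C \<epsilon> X k = (\<lambda>(cs, x).
     if k + 1 < length cs
     then (take k cs @ [lact C (\<epsilon> (cs ! k)) (cs ! (k + 1))] @ drop (k + 2) cs, x)
     else (take k cs, lact X (\<epsilon> (cs ! k)) x))"

text \<open>The face \<open>Z\<^sub>n \<rightarrow> Z\<^sub>n\<^sub>-\<^sub>1\<close>, for \<open>n \<ge> 1\<close>.\<close>

definition Z_face ::
  "('k::{comm_ring, comm_monoid_mult}, 'r, 'c::ab_group_add) bimod
    \<Rightarrow> ('c \<Rightarrow> 'r) \<Rightarrow> ('k, 'r, 'x::ab_group_add) bimod \<Rightarrow> nat \<Rightarrow> nat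
    \<Rightarrow> ('c list \<times> 'x \<Rightarrow>\<^sub>0 'k) set \<Rightarrow> ('c list \<times> 'x \<Rightarrow>\<^sub>0 'k) set" where
  "Z_face C \<epsilon> X n k z =
     psum (cyclic_tensor C X (n - 1)) z (\<lambda>y. gen (cyclic_tensor C X (n - 1)) (face_word C \<epsilon> X k y))"

definition Z_degen ::
  "('k::{comm_ring, comm_monoid_mult}, 'r, 'c::ab_group_add) bimod
    \<Rightarrow> ('c \<Rightarrow> ('c \<times> 'c \<Rightarrow>\<^sub>0 'k) set) \<Rightarrow> ('k, 'r, 'x::ab_group_add) bimod \<Rightarrow> nat \<Rightarrow> nat
    \<Rightarrow> ('c list \<times> 'x \<Rightarrow>\<^sub>0 'k) set \<Rightarrow> ('c list \<times> 'x \<Rightarrow>\<^sub>0 'k) set" where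
  "Z_degen C \<Delta> X n k z =
     psum (cyclic_tensor C X (n + 1)) z (\<lambda>(cs, x).
       psum (cyclic_tensor C X (n + 1)) (\<Delta> (cs ! k)) (\<lambda>(c1, c2).
         gen (cyclic_tensor C X (n + 1)) (take k cs @ [c1, c2] @ drop (k + 1) cs, x)))"

text \<open>In \<open>d n k\<close>, \<open>s n k\<close> and \<open>w n\<close> below, the index \<open>n\<close> is the degree of the domain.\<close>

definition simplicial_module ::
  "(nat \<Rightarrow> ('w, 'k::{comm_ring, comm_monoid_mult}) presentation)
    \<Rightarrow> (nat \<Rightarrow> nat \<Rightarrow> ('w \<Rightarrow>\<^sub>0 'k) set \<Rightarrow> ('w \<Rightarrow>\<^sub>0 'k) set)
    \<Rightarrow> (nat \<Rightarrow> nat \<Rightarrow> ('w \<Rightarrow>\<^sub>0 'k) set \<Rightarrow> ('w \<Rightarrow>\<^sub>0 'k) set) \<Rightarrow> bool" where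
  "simplicial_module Z d s \<longleftrightarrow>
     (\<forall>n \<ge> 1. \<forall>k \<le> n. phom (Z n) (Z (n - 1)) (d n k)) \<and>
     (\<forall>n. \<forall>k \<le> n. phom (Z n) (Z (n + 1)) (s n k)) \<and>
     (\<forall>n \<ge> 2. \<forall>j \<le> n. \<forall>i < j. \<forall>z \<in> pcarrier (Z n).
        d (n - 1) i (d n j z) = d (n - 1) (j - 1) (d n i z)) \<and>
     (\<forall>n. \<forall>j \<le> n. \<forall>i \<le> j. \<forall>z \<in> pcarrier (Z n).
        s (n + 1) i (s n j z) = s (n + 1) (j + 1) (s n i z)) \<and>
     (\<forall>n. \<forall>j \<le> n. \<forall>i < j. \<forall>z \<in> pcarrier (Z n).
        d (n + 1) i (s n j z) = s (n - 1) (j - 1) (d n i z)) \<and>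
     (\<forall>n. \<forall>j \<le> n. \<forall>z \<in> pcarrier (Z n).
        d (n + 1) j (s n j z) = z \<and> d (n + 1) (j + 1) (s n j z) = z) \<and>
     (\<forall>n. \<forall>j \<le> n. \<forall>i \<le> n + 1. \<forall>z \<in> pcarrier (Z n). j + 1 < i \<longrightarrow>
        d (n + 1) i (s n j z) = s (n - 1) j (d n (i - 1) z))"

definition para_cyclic_structure ::
  "(nat \<Rightarrow> ('w, 'k::{comm_ring, comm_monoid_mult}) presentation)
    \<Rightarrow> (nat \<Rightarrow> nat \<Rightarrow> ('w \<Rightarrow>\<^sub>0 'k) set \<Rightarrow> ('w \<Rightarrow>\<^sub>0 'k) set)
    \<Rightarrow> (nat \<Rightarrow> nat \<Rightarrow> ('w \<Rightarrow>\<^sub>0 'k) set \<Rightarrow> ('w \<Rightarrow>\<^sub>0 'k) set)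
    \<Rightarrow> (nat \<Rightarrow> ('w \<Rightarrow>\<^sub>0 'k) set \<Rightarrow> ('w \<Rightarrow>\<^sub>0 'k) set) \<Rightarrow> bool" where
  "para_cyclic_structure Z d s w \<longleftrightarrow>
     (\<forall>n. phom (Z n) (Z n) (w n)) \<and>
     (\<forall>n \<ge> 1. \<forall>z \<in> pcarrier (Z n). d n 0 (w n z) = d n n z) \<and>
     (\<forall>n \<ge> 1. \<forall>k \<in> {1..n}. \<forall>z \<in> pcarrier (Z n). d n k (w n z) = w (n - 1) (d n (k - 1) z)) \<and>
     (\<forall>n. \<forall>z \<in> pcarrier (Z n). s n 0 (w n z) = w (n + 1) (w (n + 1) (s n n z))) \<and>
     (\<forall>n. \<forall>k \<in> {1..n}. \<forall>z \<in> pcarrier (Z n). s n k (w n z) = w (n + 1) (s n (k - 1) z))"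

end

theory Submission
  imports Defs
begin

text \<open>
  Coassociativity and the counit show that the coaction is right linear in the form
  \<open>\<rho>(c \<cdot> r) = c\<^sub>[\<^sub>-\<^sub>1\<^sub>] \<xi>(r) \<otimes> c\<^sub>[\<^sub>0\<^sub>]\<close>, and that it takes values in the Takeuchi product:
  \<open>c\<^sub>[\<^sub>-\<^sub>1\<^sub>] \<zeta>(r) \<otimes> c\<^sub>[\<^sub>0\<^sub>] = c\<^sub>[\<^sub>-\<^sub>1\<^sub>] \<otimes> c\<^sub>[\<^sub>0\<^sub>] \<cdot> r\<close>.  The first identity makes \<open>w\<close> well
  defined, the second makes \<open>w\<close> right linear and makes \<open>w\<^sub>n\<close> compatible with the cyclic relation
  \<open>r \<cdot> y = y \<cdot> r\<close>.  The two comodule coring axioms are then the counit and comultiplication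
  conditions on \<open>w\<close>; in \<open>Z\<^sub>n\<close> they give \<open>d\<^sub>0 w\<^sub>n = d\<^sub>n\<close> and \<open>s\<^sub>0 w\<^sub>n = w\<^sub>n\<^sub>+\<^sub>1\<^sup>2 s\<^sub>n\<close>, while the other
  relations hold on tensor monomials by inspection.
\<close>


section \<open>Linear maps between modules given by generators and relations\<close>

text \<open>Sweedler sums in the definitions run over chosen representatives, and a chosen
  representative depends linearly on its class only modulo the relations. Every operator is
  therefore described by its values on words, as elements of a free module. This separates two
  tasks: to show that these values respect the relations, and to compare two composites word by
  word, up to congruence. A representative may be exchanged for another one only under a balanced
  summand; the lemmas on comultiplication and coaction are stated for an arbitrary balanced summand,
  so that one identity serves in \<open>C \<otimes> X\<close>, in triple tensor products and in the
  cyclic ones.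

  Both right linearity properties arise by applying one balanced trilinear map to the
  coassociativity of the coaction: the side with two coactions yields the induced right action, and
  on the side with \<open>\<Delta>\<close> the counit collapses the sum.

  In the cyclic quotient the relation \<open>r \<cdot> y = y \<cdot> r\<close> acts as one more
  tensor sign, between \<open>X\<close> and the first factor. Thus a rotation is again a
  transposition of the last letter with \<open>x\<close>, and the arguments for \<open>w\<close>
  carry over to \<open>w_n\<close>.\<close>

definition ceq :: "'a::ab_group_add set \<Rightarrow> 'a \<Rightarrow> 'a \<Rightarrow> bool" where
  "ceq S a b \<longleftrightarrow> a - b \<in> S"

abbreviation rspan :: "('w, 'k::{comm_ring, comm_monoid_mult}) presentation \<Rightarrow> ('w \<Rightarrow>\<^sub>0 'k) set" where
  "rspan P \<equiv> fspan (rels P)"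

abbreviation fext :: "('w \<Rightarrow> ('v \<Rightarrow>\<^sub>0 'k)) \<Rightarrow> ('w \<Rightarrow>\<^sub>0 'k::{comm_ring, comm_monoid_mult}) \<Rightarrow> ('v \<Rightarrow>\<^sub>0 'k)"
  where "fext \<equiv> linext fscale"

lemma lookup_fscale: "Poly_Mapping.lookup (fscale k p) w = k * Poly_Mapping.lookup p w"
  by (simp add: fscale_def Poly_Mapping.map.rep_eq when_def)

interpretation free: k_module fscale
  by unfold_locales (auto intro!: poly_mapping_eqI simp: lookup_fscale lookup_add algebra_simps)

context k_module
begin

lemma scale_zero_right [simp]: "s k 0 = 0"
  using scale_add_right[of k 0 0] by simp

lemma scale_zero_left [simp]: "s 0 m = 0"
  using scale_add_left[of 0 0 m] by simp

lemma scale_minus_right: "s k (- m) = - s k m"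
  using scale_add_right[of k m "- m"] by (simp add: eq_neg_iff_add_eq_0 add.commute)

lemma scale_diff_right: "s k (m - m') = s k m - s k m'"
  using scale_add_right[of k m "- m'"] by (simp add: scale_minus_right)

lemma scale_sum_right: "s k (\<Sum>i\<in>I. f i) = (\<Sum>i\<in>I. s k (f i))"
  by (induction I rule: infinite_finite_induct) (auto simp: scale_add_right)

text \<open>Supports can shrink under addition and scaling, so sums are compared over a common
  finite set containing the supports.\<close>

lemma linext_superset:
  assumes "finite A" "Poly_Mapping.keys p \<subseteq> A"
  shows "linext s f p = (\<Sum>w\<in>A. s (Poly_Mapping.lookup p w) (f w))"
  unfolding linext_def using assms
  by (intro sum.mono_neutral_left) (auto simp: in_keys_iff)

lemma linext_add: "linext s f (p + q) = linext s f p + linext s f q"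
proof -
  let ?A = "Poly_Mapping.keys p \<union> Poly_Mapping.keys q"
  have "Poly_Mapping.keys (p + q) \<subseteq> ?A" by (rule keys_add)
  then show ?thesis
    by (simp add: linext_superset[of ?A] lookup_add scale_add_left sum.distrib)
qed

lemma linext_fscale: "linext s f (fscale k p) = s k (linext s f p)"
proof -
  have "Poly_Mapping.keys (fscale k p) \<subseteq> Poly_Mapping.keys p"
    by (auto simp: in_keys_iff lookup_fscale)
  then show ?thesis
    by (simp add: linext_superset[of "Poly_Mapping.keys p"] lookup_fscale scale_sum_right scale_scale)
qed

lemma linext_zero [simp]: "linext s f 0 = 0"
  by (simp add: linext_def)

lemma linext_diff: "linext s f (p - q) = linext s f p - linext s f q"
  using linext_add[of f "p - q" q] by simp

lemma linext_monom [simp]: "linext s f (monom w) = f w"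
proof -
  have "linext s f (monom w) = s (Poly_Mapping.lookup (monom w) w) (f w)"
    by (subst linext_superset[of "{w}"]) (auto simp: monom_def)
  then show ?thesis by (simp add: monom_def scale_one)
qed

text \<open>Fubini for two independent Sweedler sums; it rests on commutativity of the
  scalars.\<close>

lemma linext_swap:
  "linext s (\<lambda>v. linext s (\<lambda>w. h v w) q) p = linext s (\<lambda>w. linext s (\<lambda>v. h v w) p) q"
  unfolding linext_def scale_sum_right
  by (subst sum.swap) (simp add: scale_scale mult.commute)

end

text \<open>Linearity into the quotient by \<open>S\<close> without forming the quotient, as
  satisfied by maps like \<open>c \<mapsto> rep (\<Delta> c)\<close>.\<close>

definition linear_mod ::
  "('k \<Rightarrow> 'm::ab_group_add \<Rightarrow> 'm) \<Rightarrow> ('k \<Rightarrow> 'n::ab_group_add \<Rightarrow> 'n) \<Rightarrow> 'n set \<Rightarrow> ('m \<Rightarrow> 'n) \<Rightarrow> bool" where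
  "linear_mod t s S \<phi> \<longleftrightarrow>
     (\<forall>a b. ceq S (\<phi> (a + b)) (\<phi> a + \<phi> b)) \<and> (\<forall>k a. ceq S (\<phi> (t k a)) (s k (\<phi> a)))"

lemma linear_mod_comp:
  "linear_mod t s S \<phi> \<Longrightarrow> k_linear u t g \<Longrightarrow> linear_mod u s S (\<lambda>a. \<phi> (g a))"
  by (simp add: linear_mod_def k_linear_def)

locale k_submodule = k_module s
  for s :: "'k::{comm_ring, comm_monoid_mult} \<Rightarrow> 'm::ab_group_add \<Rightarrow> 'm" +
  fixes S :: "'m set"
  assumes sub_zero: "0 \<in> S"
    and sub_add: "a \<in> S \<Longrightarrow> b \<in> S \<Longrightarrow> a + b \<in> S"
    and sub_scale: "a \<in> S \<Longrightarrow> s k a \<in> S"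
begin

lemma sub_minus: "a \<in> S \<Longrightarrow> - a \<in> S"
  using sub_scale[of a "-1"] scale_add_left[of 1 "-1" a] by (simp add: scale_one eq_neg_iff_add_eq_0 minus_unique)

lemma ceq_refl [simp]: "ceq S a a"
  by (simp add: ceq_def sub_zero)

lemma ceq_sym: "ceq S a b \<Longrightarrow> ceq S b a"
  using sub_minus[of "a - b"] by (simp add: ceq_def)

lemma ceq_trans: "ceq S a b \<Longrightarrow> ceq S b c \<Longrightarrow> ceq S a c"
  using sub_add[of "a - b" "b - c"] by (simp add: ceq_def)

lemma ceq_add: "ceq S a b \<Longrightarrow> ceq S a' b' \<Longrightarrow> ceq S (a + a') (b + b')"
  using sub_add[of "a - b" "a' - b'"] by (simp add: ceq_def algebra_simps)

lemma ceq_scale: "ceq S a b \<Longrightarrow> ceq S (s k a) (s k b)"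
  using sub_scale[of "a - b" k] by (simp add: ceq_def scale_diff_right)

lemma ceq_linext:
  assumes "\<And>w. w \<in> Poly_Mapping.keys p \<Longrightarrow> ceq S (f w) (g w)"
  shows "ceq S (linext s f p) (linext s g p)"
proof -
  have "finite K \<Longrightarrow> K \<subseteq> Poly_Mapping.keys p \<Longrightarrow>
      ceq S (\<Sum>w\<in>K. s (Poly_Mapping.lookup p w) (f w)) (\<Sum>w\<in>K. s (Poly_Mapping.lookup p w) (g w))" for K
    by (induction K rule: finite_induct) (auto intro: ceq_add ceq_scale assms)
  then show ?thesis unfolding linext_def by simp
qed

lemma ceq_map_linext:
  assumes "linear_mod t s S \<phi>"
  shows "ceq S (\<phi> (linext t f p)) (linext s (\<lambda>w. \<phi> (f w)) p)"
proof -
  \<comment> \<open>Additivity modulo \<open>S\<close> at \<open>0 + 0\<close> puts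
    \<open>- \<phi> 0\<close> into \<open>S\<close>; this is the base of the induction
    below.\<close>
  have "ceq S (\<phi> 0) 0"
  proof -
    have "\<phi> (0 + 0) - (\<phi> 0 + \<phi> 0) \<in> S" using assms unfolding linear_mod_def ceq_def by blast
    then show ?thesis using sub_minus[of "- \<phi> 0"] by (simp add: ceq_def)
  qed
  have "finite K \<Longrightarrow>
      ceq S (\<phi> (\<Sum>w\<in>K. t (Poly_Mapping.lookup p w) (f w)))
            (\<Sum>w\<in>K. s (Poly_Mapping.lookup p w) (\<phi> (f w)))" for K
  proof (induction K rule: finite_induct)
    case (insert w K)
    have "ceq S (\<phi> (t k a + b)) (s k (\<phi> a) + c)" if "ceq S (\<phi> b) c" for k a b c
      using assms that unfolding linear_mod_def by (metis ceq_trans ceq_add)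
    then show ?case using insert by simp
  qed (simp add: \<open>ceq S (\<phi> 0) 0\<close>)
  then show ?thesis unfolding linext_def by simp
qed

lemma linear_mod_linext:
  assumes "\<And>w. w \<in> Poly_Mapping.keys p \<Longrightarrow> linear_mod t s S (\<lambda>a. f a w)"
  shows "linear_mod t s S (\<lambda>a. linext s (f a) p)"
  unfolding linear_mod_def
proof safe
  fix a b
  have "ceq S (linext s (f (a + b)) p) (linext s (\<lambda>w. f a w + f b w) p)"
    using assms by (intro ceq_linext) (simp add: linear_mod_def)
  then show "ceq S (linext s (f (a + b)) p) (linext s (f a) p + linext s (f b) p)"
    by (simp add: linext_def scale_add_right sum.distrib)
next
  fix k a
  have "ceq S (linext s (f (t k a)) p) (linext s (\<lambda>w. s k (f a w)) p)"
    using assms by (intro ceq_linext) (simp add: linear_mod_def)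
  then show "ceq S (linext s (f (t k a)) p) (s k (linext s (f a) p))"
    by (simp add: linext_def scale_sum_right scale_scale mult.commute)
qed

text \<open>Moves a Sweedler sum into a single linear slot, where a counit axiom can evaluate
  it.\<close>

lemma ceq_linext_map2:
  assumes "linear_mod t s S \<phi>"
  shows "ceq S (linext s (\<lambda>(v, w). \<phi> (f v w)) p) (\<phi> (linext t (\<lambda>(v, w). f v w) p))"
  using ceq_sym[OF ceq_map_linext[OF assms]] by (simp add: case_prod_unfold)

lemma ceq_linext2:
  assumes "\<And>v w. ceq S (f v w) (g v w)"
  shows "ceq S (linext s (\<lambda>(v, w). f v w) p) (linext s (\<lambda>(v, w). g v w) p)"
  using assms by (intro ceq_linext) auto

lemma linear_mod_linext2:
  assumes "\<And>v w. linear_mod t s S (\<lambda>a. f a v w)"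
  shows "linear_mod t s S (\<lambda>a. linext s (\<lambda>(v, w). f a v w) p)"
  using assms by (intro linear_mod_linext) auto

text \<open>A summand that is insensitive to the error modulo \<open>T\<close> turns the approximate
  linearity of \<open>D\<close> into linearity modulo \<open>S\<close>.\<close>

lemma linear_mod_linext_arg:
  assumes "linear_mod t fscale T D" "\<And>p q. ceq T p q \<Longrightarrow> ceq S (linext s f p) (linext s f q)"
  shows "linear_mod t s S (\<lambda>a. linext s f (D a))"
  using assms unfolding linear_mod_def linext_add[symmetric] linext_fscale[symmetric] by blast

lemma ceq_linext_fspan:
  assumes "\<And>a. a \<in> A \<Longrightarrow> linext s f a \<in> S" and "ceq (fspan A) p q"
  shows "ceq S (linext s f p) (linext s f q)"
proof -
  have "d \<in> fspan A \<Longrightarrow> linext s f d \<in> S" for d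
    by (induction rule: fspan.induct)
      (auto simp: sub_zero linext_add linext_fscale intro: assms(1) sub_add sub_scale)
  then show ?thesis using assms(2) by (simp add: ceq_def flip: linext_diff)
qed

end

lemma (in k_module) k_submodule_zero: "k_submodule s {0}"
  by unfold_locales auto

lemma ceq_zero [simp]: "ceq {0} a b \<longleftrightarrow> a = b"
  by (simp add: ceq_def)

interpretation span: k_submodule fscale "fspan A" for A
  by unfold_locales (auto intro: fspan.intros)

lemmas span_trans [trans] = span.ceq_trans

lemma span_eq_trans [trans]:
  "a = b \<Longrightarrow> ceq S b c \<Longrightarrow> ceq S a c" "ceq S a b \<Longrightarrow> b = c \<Longrightarrow> ceq S a c"
  by auto

lemma (in k_module) linear_linext:
  assumes "k_linear t s \<phi>"
  shows "\<phi> (linext t f p) = linext s (\<lambda>w. \<phi> (f w)) p"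
  using k_submodule.ceq_map_linext[OF k_submodule_zero, of t \<phi> f p] assms
  by (simp add: k_linear_def linear_mod_def)

lemma (in k_module) linext_fext:
  "linext s f (fext g p) = linext s (\<lambda>w. linext s f (g w)) p"
  by (rule linear_linext) (simp add: k_linear_def linext_add linext_fscale)

lemma (in k_module) linext_push: "linext s f (push g p) = linext s (\<lambda>w. f (g w)) p"
  by (simp add: push_def linext_fext)

text \<open>Carriers admit only combinations of generator words, so a map of presented modules needs
  control of supports; in \<open>cyclic_tensor\<close> this keeps track of word length.\<close>

lemma keys_fext: "Poly_Mapping.keys (fext f p) \<subseteq> (\<Union>w\<in>Poly_Mapping.keys p. Poly_Mapping.keys (f w))"
proof
  fix v assume "v \<in> Poly_Mapping.keys (fext f p)"
  then have "(\<Sum>w\<in>Poly_Mapping.keys p. Poly_Mapping.lookup p w * Poly_Mapping.lookup (f w) v) \<noteq> 0"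
    by (simp add: in_keys_iff linext_def lookup_sum lookup_fscale)
  then obtain w where "w \<in> Poly_Mapping.keys p" "Poly_Mapping.lookup (f w) v \<noteq> 0"
    by (metis (no_types, lifting) mult_zero_right sum.not_neutral_contains_not_neutral)
  then show "v \<in> (\<Union>w\<in>Poly_Mapping.keys p. Poly_Mapping.keys (f w))"
    by (auto simp: in_keys_iff)
qed

lemma fext_monom [simp]: "fext monom p = p"
proof (rule poly_mapping_eqI)
  fix v
  have "Poly_Mapping.lookup (fext monom p) v =
      (\<Sum>w\<in>Poly_Mapping.keys p. if w = v then Poly_Mapping.lookup p w else 0)"
    by (simp add: linext_def lookup_sum lookup_fscale monom_def lookup_single when_def if_distrib cong: if_cong)
  also have "\<dots> = Poly_Mapping.lookup p v"
    by (simp add: in_keys_iff)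
  finally show "Poly_Mapping.lookup (fext monom p) v = Poly_Mapping.lookup p v" .
qed

text \<open>All \<open>p\<close> are allowed, not only those supported on \<open>gens P\<close>: a
  coset depends on the relations alone. Generators enter only in \<open>induces_eq\<close> and
  \<open>phom_induces\<close>.\<close>

definition induces ::
  "('w, 'k::{comm_ring, comm_monoid_mult}) presentation \<Rightarrow> ('v, 'k) presentation
    \<Rightarrow> (('w \<Rightarrow>\<^sub>0 'k) set \<Rightarrow> ('v \<Rightarrow>\<^sub>0 'k) set) \<Rightarrow> ('w \<Rightarrow> ('v \<Rightarrow>\<^sub>0 'k)) \<Rightarrow> bool" where
  "induces P Q F f \<longleftrightarrow> (\<forall>p. F (coset P p) = coset Q (fext f p))"

definition descends ::
  "('w, 'k::{comm_ring, comm_monoid_mult}) presentation \<Rightarrow> ('v \<Rightarrow>\<^sub>0 'k) set \<Rightarrow> ('w \<Rightarrow> ('v \<Rightarrow>\<^sub>0 'k)) \<Rightarrow> bool" where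
  "descends P S f \<longleftrightarrow> (\<forall>p q. ceq (rspan P) p q \<longrightarrow> ceq S (fext f p) (fext f q))"

lemma coset_eq_iff: "coset P p = coset P q \<longleftrightarrow> ceq (rspan P) p q"
proof
  assume "coset P p = coset P q"
  moreover have "p \<in> coset P p" using span.ceq_refl[of "rels P" p] by (simp add: coset_def ceq_def)
  ultimately show "ceq (rspan P) p q" by (simp add: coset_def ceq_def)
next
  assume *: "ceq (rspan P) p q"
  have "ceq (rspan P) r p \<longleftrightarrow> ceq (rspan P) r q" for r
    using * span.ceq_trans span.ceq_sym by metis
  then show "coset P p = coset P q" by (simp add: coset_def ceq_def)
qed

text \<open>The one place where the choice behind \<open>rep\<close> is opened; everything else
  about representatives follows from this congruence.\<close>

lemma rep_coset: "ceq (rspan P) (rep (coset P p)) p"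
proof -
  have "p \<in> coset P p" using span.ceq_refl[of "rels P" p] by (simp add: coset_def ceq_def)
  then have "rep (coset P p) \<in> coset P p" unfolding rep_def by (rule someI)
  then show ?thesis by (simp add: coset_def ceq_def)
qed

lemma coset_rep: "t \<in> pcarrier P \<Longrightarrow> coset P (rep t) = t"
  using rep_coset by (fastforce simp: pcarrier_def simp flip: coset_eq_iff)

lemma padd_coset: "padd P (coset P p) (coset P q) = coset P (p + q)"
  by (simp add: padd_def coset_eq_iff rep_coset span.ceq_add)

lemma pscale_coset: "pscale P k (coset P p) = coset P (fscale k p)"
  by (simp add: pscale_def coset_eq_iff rep_coset span.ceq_scale)

lemma psum_rep: "psum Q t (\<lambda>w. coset Q (f w)) = coset Q (fext f (rep t))"
  by (simp add: psum_def coset_eq_iff rep_coset span.ceq_linext)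

lemma psum_gen: "psum Q t (\<lambda>w. gen Q (f w)) = coset Q (fext (\<lambda>w. monom (f w)) (rep t))"
  by (simp add: gen_def psum_rep)

text \<open>\<open>psum\<close> evaluates \<open>f\<close> on one representative, and
  \<open>descends\<close> says that any other gives the same class.\<close>

lemma induces_psum:
  assumes "descends P (rspan Q) f"
  shows "induces P Q (\<lambda>t. psum Q t (\<lambda>w. coset Q (f w))) f"
  using assms rep_coset[of P] by (simp add: induces_def psum_rep coset_eq_iff descends_def)

lemma induces_comp:
  assumes "induces P Q F f" "induces Q R G g"
  shows "induces P R (\<lambda>t. G (F t)) (\<lambda>w. fext g (f w))"
  using assms by (simp add: induces_def free.linext_fext)

lemma induces_id: "induces P P (\<lambda>t. t) monom"
  by (simp add: induces_def)

text \<open>The principle by which all operator identities are proved: a class in the carrier has a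
  representative made of generator words, so a congruence on those words suffices.\<close>

lemma induces_eq:
  assumes "induces P Q F f" "induces P Q G g" "\<And>w. w \<in> gens P \<Longrightarrow> ceq (rspan Q) (f w) (g w)"
    and "t \<in> pcarrier P"
  shows "F t = G t"
proof -
  obtain p where "t = coset P p" "Poly_Mapping.keys p \<subseteq> gens P" using assms(4) by (auto simp: pcarrier_def)
  then have "ceq (rspan Q) (fext f p) (fext g p)" using assms(3) by (intro span.ceq_linext) blast
  then show ?thesis using assms(1,2) \<open>t = _\<close> by (simp add: induces_def coset_eq_iff)
qed

lemma phom_induces:
  assumes F: "induces P Q F f" and keys: "\<And>w. w \<in> gens P \<Longrightarrow> Poly_Mapping.keys (f w) \<subseteq> gens Q"
  shows "phom P Q F"
  unfolding phom_def
proof (intro conjI ballI allI)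
  fix t assume "t \<in> pcarrier P"
  then obtain p where "t = coset P p" "Poly_Mapping.keys p \<subseteq> gens P" by (auto simp: pcarrier_def)
  moreover from this have "Poly_Mapping.keys (fext f p) \<subseteq> gens Q" using keys_fext[of f p] keys by blast
  ultimately show "F t \<in> pcarrier Q" using F by (auto simp: induces_def pcarrier_def)
next
  fix t u assume "t \<in> pcarrier P" "u \<in> pcarrier P"
  then show "F (padd P t u) = padd Q (F t) (F u)"
    using F by (auto simp: induces_def pcarrier_def padd_coset free.linext_add)
next
  fix k t assume "t \<in> pcarrier P"
  then show "F (pscale P k t) = pscale Q k (F t)"
    using F by (auto simp: induces_def pcarrier_def pscale_coset free.linext_fscale)
qed

section \<open>Balanced maps and the relations of tensor products\<close>

text \<open>The congruence \<open>ceq S\<close> instead of equality lets one notion of balanced map serve both for maps into a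
  module (\<open>S = {0}\<close>) and for maps into a module given by relations.\<close>

definition balanced ::
  "('k \<Rightarrow> 'a \<Rightarrow> 'a) \<Rightarrow> 'a set \<Rightarrow> ('k, 'r, 'm::ab_group_add, 'y) bimod_scheme
    \<Rightarrow> ('k, 'r, 'n::ab_group_add, 'z) lmod_scheme \<Rightarrow> ('m \<Rightarrow> 'n \<Rightarrow> 'a::ab_group_add) \<Rightarrow> bool" where
  "balanced s S M N f \<longleftrightarrow>
     (\<forall>n. linear_mod (scale M) s S (\<lambda>m. f m n)) \<and> (\<forall>m. linear_mod (scale N) s S (f m)) \<and>
     (\<forall>m r n. ceq S (f (ract M m r) n) (f m (lact N r n)))"

lemma balancedI:
  assumes "\<And>n. linear_mod (scale M) s S (\<lambda>m. f m n)" "\<And>m. linear_mod (scale N) s S (f m)"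
    and "\<And>m r n. ceq S (f (ract M m r) n) (f m (lact N r n))"
  shows "balanced s S M N f"
  using assms by (simp add: balanced_def)

lemma balancedD:
  assumes "balanced s S M N f"
  shows "linear_mod (scale M) s S (\<lambda>m. f m n)" "linear_mod (scale N) s S (f m)"
    and "ceq S (f (ract M m r) n) (f m (lact N r n))"
  using assms by (simp_all add: balanced_def)

lemma (in k_submodule) balanced_rels:
  assumes "balanced s S M N f" "\<rho> \<in> tensor_rels M N"
  shows "linext s (\<lambda>(m, n). f m n) \<rho> \<in> S"
  using assms unfolding balanced_def linear_mod_def tensor_rels_def ceq_def
  by (auto simp: linext_diff linext_fscale diff_diff_eq[symmetric])

lemma (in k_submodule) ceq_linext_balanced:
  assumes "balanced s S M N f" "ceq (fspan (tensor_rels M N)) p q"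
  shows "ceq S (linext s (\<lambda>(m, n). f m n) p) (linext s (\<lambda>(m, n). f m n) q)"
  using balanced_rels[OF assms(1)] assms(2) by (rule ceq_linext_fspan)

text \<open>Each relation of \<open>tensor3\<close> is a relation of two adjacent factors with the
  remaining entry frozen, so balance in each adjacent pair is enough.\<close>

lemma (in k_submodule) ceq_linext_trilinear:
  assumes "\<And>p. balanced s S M N (\<lambda>m n. f m n p)" "\<And>m. balanced s S N P (f m)"
    and "ceq (rspan (tensor3 M N P)) p q"
  shows "ceq S (linext s (\<lambda>(m, n, p). f m n p) p) (linext s (\<lambda>(m, n, p). f m n p) q)"
proof (rule ceq_linext_fspan[OF _ assms(3)])
  fix a assume "a \<in> rels (tensor3 M N P)"
  then consider (left) \<rho> p where "a = push (\<lambda>(m, n). (m, n, p)) \<rho>" "\<rho> \<in> tensor_rels M N"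
    | (right) \<rho> m where "a = push (\<lambda>(n, p). (m, n, p)) \<rho>" "\<rho> \<in> tensor_rels N P"
    by (auto simp: tensor3_def)
  then show "linext s (\<lambda>(m, n, p). f m n p) a \<in> S"
  proof cases
    case left
    then show ?thesis using balanced_rels[OF assms(1)] by (simp add: linext_push case_prod_unfold)
  next
    case right
    then show ?thesis using balanced_rels[OF assms(2)] by (simp add: linext_push case_prod_unfold)
  qed
qed

lemma tensor_relsI:
  "monom (m + m', n) - monom (m, n) - monom (m', n) \<in> tensor_rels M N"
  "monom (m, n + n') - monom (m, n) - monom (m, n') \<in> tensor_rels M N"
  "monom (scale M k m, n) - fscale k (monom (m, n)) \<in> tensor_rels M N"
  "monom (m, scale N k n) - fscale k (monom (m, n)) \<in> tensor_rels M N"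
  "monom (ract M m r, n) - monom (m, lact N r n) \<in> tensor_rels M N"
  by (simp only: tensor_rels_def, blast)+

text \<open>Converse direction to \<open>balanced_rels\<close>: if the images of all tensor
  relations are relations, the words themselves form a balanced map.\<close>

lemma balanced_push:
  assumes "push (\<lambda>(m, n). g m n) ` tensor_rels M N \<subseteq> A"
  shows "balanced fscale (fspan A) M N (\<lambda>m n. monom (g m n))"
proof -
  have "fext (\<lambda>(m, n). monom (g m n)) \<rho> \<in> fspan A" if "\<rho> \<in> tensor_rels M N" for \<rho>
    using assms that by (auto simp: push_def case_prod_unfold intro: fspan_base)
  note rel = tensor_relsI[THEN this, unfolded free.linext_diff free.linext_fscale free.linext_monom prod.case]
  show ?thesis
    using rel by (intro balancedI) (simp_all add: linear_mod_def ceq_def diff_diff_eq)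
qed

lemma push_id: "push id p = p"
  by (simp add: push_def)

lemma rels_tensor2 [simp]: "rels (tensor2 M N) = tensor_rels M N" "gens (tensor2 M N) = UNIV"
  by (simp_all add: tensor2_def)

lemma balanced_monom: "balanced fscale (fspan (tensor_rels M N)) M N (\<lambda>m n. monom (m, n))"
  by (rule balanced_push) (auto simp: push_id)

lemma balanced_monom3:
  "balanced fscale (rspan (tensor3 M N P)) M N (\<lambda>m n. monom (m, n, p))"
  "balanced fscale (rspan (tensor3 M N P)) N P (\<lambda>n p. monom (m, n, p))"
  by (rule balanced_push; auto simp: tensor3_def)+

lemma psum_gen2:
  "psum Q t (\<lambda>(m, n). gen Q (g m n)) = coset Q (fext (\<lambda>(m, n). monom (g m n)) (rep t))"
  by (simp add: case_prod_unfold psum_gen)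

lemma psum_rep2:
  "psum Q t (\<lambda>(m, n). coset Q (f m n)) = coset Q (fext (\<lambda>(m, n). f m n) (rep t))"
  by (simp add: case_prod_unfold psum_rep)

text \<open>Transfers the linearity of \<open>\<Delta>\<close> and \<open>\<rho>\<close>, which take
  values in classes, to their chosen representatives.\<close>

lemma linear_into_rep:
  assumes "linear_into s Q f"
  shows "linear_mod s fscale (rspan Q) (\<lambda>m. rep (f m))" and "coset Q (rep (f m)) = f m"
  using assms rep_coset[of Q]
  by (auto simp: linear_into_def linear_mod_def padd_def pscale_def coset_rep)


section \<open>The simplicial module of a coring\<close>

lemma (in left_module) lact_simps [simp]:
  "lact V a (v + w) = lact V a v + lact V a w" "lact V a (scale V k v) = scale V k (lact V a v)"
  "lact V (a + b) v = lact V a v + lact V b v" "lact V (sA k a) v = scale V k (lact V a v)"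
  "lact V 1 v = v"
  using lact_linear[of a] lact_linear_ring[of v] lact_one by (simp_all add: k_linear_def)

lemma (in bimodule) ract_simps [simp]:
  "ract M (v + w) r = ract M v r + ract M w r" "ract M (scale M k v) r = scale M k (ract M v r)"
  "ract M v (r + r') = ract M v r + ract M v r'" "ract M v (sR k r) = scale M k (ract M v r)"
  "ract M v 1 = v"
  using ract_linear[of r] ract_linear_ring[of v] ract_one by (simp_all add: k_linear_def)

locale coring_and_bimodule = C: coring sR C \<Delta> \<epsilon> + X: bimodule sR X
  for sR :: "'k::{comm_ring, comm_monoid_mult} \<Rightarrow> 'r::{ring, monoid_mult} \<Rightarrow> 'r"
    and C :: "('k, 'r, 'c::ab_group_add) bimod"
    and \<Delta> :: "'c \<Rightarrow> ('c \<times> 'c \<Rightarrow>\<^sub>0 'k) set"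
    and \<epsilon> :: "'c \<Rightarrow> 'r"
    and X :: "('k, 'r, 'x::ab_group_add) bimod"

section \<open>The coring axioms on representatives\<close>

context coring
begin

abbreviation D where "D c \<equiv> rep (\<Delta> c)"

lemma counit_simps [simp]:
  "\<epsilon> (c + d) = \<epsilon> c + \<epsilon> d" "\<epsilon> (scale C k c) = sR k (\<epsilon> c)"
  "\<epsilon> (lact C r c) = r * \<epsilon> c" "\<epsilon> (ract C c r) = \<epsilon> c * r"
  using counit_linear counit_lact counit_ract by (simp_all add: k_linear_def)

lemma comult_linear_mod: "linear_mod (scale C) fscale (fspan (tensor_rels C C)) (\<lambda>c. D c)"
  using linear_into_rep(1)[OF comult_linear] by simp

lemma comult_coset: "coset (tensor2 C C) (D c) = \<Delta> c"
  using linear_into_rep(2)[OF comult_linear] by simp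

lemma comult_lact_rep:
  "ceq (fspan (tensor_rels C C)) (D (lact C r c)) (fext (\<lambda>(c1, c2). monom (lact C r c1, c2)) (D c))"
  unfolding comult_lact tensor_lact_def psum_gen2 using rep_coset[of "tensor2 C C"] by simp

lemma comult_ract_rep:
  "ceq (fspan (tensor_rels C C)) (D (ract C c r)) (fext (\<lambda>(c1, c2). monom (c1, ract C c2 r)) (D c))"
  unfolding comult_ract tensor_ract_def psum_gen2 using rep_coset[of "tensor2 C C"] by simp

lemma counit_left_rep: "linext (scale C) (\<lambda>(c1, c2). lact C (\<epsilon> c1) c2) (D c) = c"
  using counit_left by (simp add: msum_def)

lemma counit_right_rep: "linext (scale C) (\<lambda>(c1, c2). ract C c1 (\<epsilon> c2)) (D c) = c"
  using counit_right by (simp add: msum_def)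

lemma coassoc_rep:
  "ceq (rspan (tensor3 C C C))
     (fext (\<lambda>(c1, c2). fext (\<lambda>(c11, c12). monom (c11, c12, c2)) (D c1)) (D c))
     (fext (\<lambda>(c1, c2). fext (\<lambda>(c21, c22). monom (c1, c21, c22)) (D c2)) (D c))"
  using coassoc[of c] by (simp add: psum_gen2 psum_rep2 coset_eq_iff)

context
  fixes A :: "('w \<Rightarrow>\<^sub>0 'k) set" and f :: "'c \<Rightarrow> 'c \<Rightarrow> ('w \<Rightarrow>\<^sub>0 'k)"
  assumes f: "balanced fscale (fspan A) C C f"
begin

lemma linear_mod_comult: "linear_mod (scale C) fscale (fspan A) (\<lambda>c. fext (\<lambda>(c1, c2). f c1 c2) (D c))"
  using comult_linear_mod span.ceq_linext_balanced[OF f] by (rule span.linear_mod_linext_arg)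

lemma ceq_comult_lact:
  "ceq (fspan A) (fext (\<lambda>(c1, c2). f c1 c2) (D (lact C r c))) (fext (\<lambda>(c1, c2). f (lact C r c1) c2) (D c))"
  using span.ceq_linext_balanced[OF f comult_lact_rep]
  by (simp add: free.linext_fext case_prod_unfold)

lemma ceq_comult_ract:
  "ceq (fspan A) (fext (\<lambda>(c1, c2). f c1 c2) (D (ract C c r))) (fext (\<lambda>(c1, c2). f c1 (ract C c2 r)) (D c))"
  using span.ceq_linext_balanced[OF f comult_ract_rep]
  by (simp add: free.linext_fext case_prod_unfold)

end

end

text \<open>Here \<open>n\<close> is the simplicial degree, so the words have \<open>n + 1\<close> letters from \<open>C\<close>.\<close>

definition multibalanced ::
  "('k \<Rightarrow> 'a \<Rightarrow> 'a) \<Rightarrow> 'a set \<Rightarrow> ('k, 'r, 'c::ab_group_add) bimod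
    \<Rightarrow> ('k, 'r, 'x::ab_group_add) bimod \<Rightarrow> nat \<Rightarrow> ('c list \<times> 'x \<Rightarrow> 'a::ab_group_add) \<Rightarrow> bool" where
  "multibalanced s S C X n f \<longleftrightarrow>
     (\<forall>as bs x. length as + length bs = n \<longrightarrow> linear_mod (scale C) s S (\<lambda>c. f (as @ c # bs, x))) \<and>
     (\<forall>cs. length cs = n + 1 \<longrightarrow> linear_mod (scale X) s S (\<lambda>x. f (cs, x))) \<and>
     (\<forall>as c r c' bs x. length as + length bs + 1 = n \<longrightarrow>
        ceq S (f (as @ ract C c r # c' # bs, x)) (f (as @ c # lact C r c' # bs, x))) \<and>
     (\<forall>as c r x. length as = n \<longrightarrow> ceq S (f (as @ [ract C c r], x)) (f (as @ [c], lact X r x))) \<and>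
     (\<forall>c r cs x. length cs = n \<longrightarrow> ceq S (f (lact C r c # cs, x)) (f (c # cs, ract X x r)))"

text \<open>\<open>r\<close> acts on whatever comes first after the prefix \<open>as\<close>; inner and last faces thus get one formula.\<close>

definition act_tail ::
  "('k, 'r, 'c) bimod \<Rightarrow> ('k, 'r, 'x) bimod \<Rightarrow> 'c list \<Rightarrow> 'r \<Rightarrow> 'c list \<Rightarrow> 'x \<Rightarrow> 'c list \<times> 'x" where
  "act_tail C X as r bs x =
     (case bs of [] \<Rightarrow> (as, lact X r x) | c # cs \<Rightarrow> (as @ lact C r c # cs, x))"

lemma act_tail_simps [simp]:
  "act_tail C X as r [] x = (as, lact X r x)"
  "act_tail C X as r (c # cs) x = (as @ lact C r c # cs, x)"
  by (simp_all add: act_tail_def)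

lemma face_word_split:
  assumes "length as = k"
  shows "face_word C \<epsilon> X k (as @ c # bs, x) = act_tail C X as (\<epsilon> c) bs x"
  using assms by (cases bs) (auto simp: face_word_def nth_append)

lemma split_nth:
  assumes "k < length cs"
  obtains as c bs where "cs = as @ c # bs" "length as = k"
  using assms id_take_nth_drop[of k cs] by (metis length_take min.absorb4)

lemma split_nth2:
  assumes "i < j" "j < length cs"
  obtains as c bs d es where "cs = as @ c # bs @ d # es" "length as = i" "length as + length bs + 1 = j"
proof -
  obtain as c bs where 1: "cs = as @ c # bs" "length as = i"
    using split_nth[of i cs] assms by auto
  then have "j - i - 1 < length bs" using assms by simp
  then obtain bs1 d es where "bs = bs1 @ d # es" "length bs1 = j - i - 1" by (rule split_nth)
  then show ?thesis using that 1 assms(1) by auto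
qed

text \<open>An operator acts at position \<open>k\<close> while a relation singles out the slot
  after \<open>as\<close>; the three outcomes organise the well-definedness proofs for faces and
  degeneracies.\<close>

lemma split_nth_cases:
  assumes "k < length as + length bs + 1"
  obtains (before) as1 d as2 where "as = as1 @ d # as2" "length as1 = k"
    | (at) "length as = k"
    | (after) bs1 d bs2 where "bs = bs1 @ d # bs2" "length as + length bs1 + 1 = k"
proof (cases k "length as" rule: linorder_cases)
  case less
  then show ?thesis using split_nth[of k as] before by metis
next
  case greater
  then have "k - length as - 1 < length bs" using assms by auto
  then obtain bs1 d bs2 where "bs = bs1 @ d # bs2" "length bs1 = k - length as - 1" by (rule split_nth)
  then show ?thesis using after greater by simp
qed (use at in simp)

lemma multibalancedD:
  assumes "multibalanced s S C X n f"
  shows "length as + length bs = n \<Longrightarrow> linear_mod (scale C) s S (\<lambda>c. f (as @ c # bs, x))"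
    and "length cs = n + 1 \<Longrightarrow> linear_mod (scale X) s S (\<lambda>x. f (cs, x))"
    and "length as + length bs + 1 = n \<Longrightarrow>
      ceq S (f (as @ ract C c r # c' # bs, x)) (f (as @ c # lact C r c' # bs, x))"
    and "length as = n \<Longrightarrow> ceq S (f (as @ [ract C c r], x)) (f (as @ [c], lact X r x))"
    and "length cs = n \<Longrightarrow> ceq S (f (lact C r c # cs, x)) (f (c # cs, ract X x r))"
  using assms by (simp_all add: multibalanced_def)

lemma balanced_cyclic:
  fixes C :: "('k::{comm_ring, comm_monoid_mult}, 'r, 'c::ab_group_add) bimod"
  shows "length as + length bs + 1 = n \<Longrightarrow>
     balanced fscale (rspan (cyclic_tensor C X n)) C C (\<lambda>c c'. monom (as @ c # c' # bs, x))"
    and "length as = n \<Longrightarrow>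
     balanced fscale (rspan (cyclic_tensor C X n)) C X (\<lambda>c x. monom (as @ [c], x))"
  by (rule balanced_push; fastforce simp: cyclic_tensor_def)+

lemma multibalanced_monom:
  fixes C :: "('k::{comm_ring, comm_monoid_mult}, 'r, 'c::ab_group_add) bimod"
    and X :: "('k, 'r, 'x::ab_group_add) bimod"
  shows "multibalanced fscale (rspan (cyclic_tensor C X n)) C X n monom"
  unfolding multibalanced_def
proof (intro conjI allI impI)
  fix as bs :: "'c list" and x :: 'x assume len: "length as + length bs = n"
  show "linear_mod (scale C) fscale (rspan (cyclic_tensor C X n)) (\<lambda>c. monom (as @ c # bs, x))"
  \<comment> \<open>Relations couple a letter with its right neighbour, which for the last letter is
    the element of \<open>X\<close>.\<close>
  proof (cases bs)
    case Nil
    then show ?thesis using len balancedD(1)[OF balanced_cyclic(2)] by simp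
  next
    case (Cons c' bs')
    then show ?thesis using len balancedD(1)[OF balanced_cyclic(1)] by simp
  qed
next
  fix cs :: "'c list" assume "length cs = n + 1"
  then obtain as c where "cs = as @ [c]" "length as = n" by (metis Suc_eq_plus1 length_Suc_conv_rev)
  then show "linear_mod (scale X) fscale (rspan (cyclic_tensor C X n)) (\<lambda>x. monom (cs, x))"
    using balancedD(2)[OF balanced_cyclic(2)] by simp
next
  fix as bs :: "'c list" and c r c' x assume "length as + length bs + 1 = n"
  then show "ceq (rspan (cyclic_tensor C X n)) (monom (as @ ract C c r # c' # bs, x))
      (monom (as @ c # lact C r c' # bs, x))"
    using balancedD(3)[OF balanced_cyclic(1)] by simp
next
  fix as :: "'c list" and c r x assume "length as = n"
  then show "ceq (rspan (cyclic_tensor C X n)) (monom (as @ [ract C c r], x))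
      (monom (as @ [c], lact X r x))"
    by (rule balancedD(3)[OF balanced_cyclic(2)])
next
  fix c r and cs :: "'c list" and x assume "length cs = n"
  then show "ceq (rspan (cyclic_tensor C X n)) (monom (lact C r c # cs, x)) (monom (c # cs, ract X x r))"
    unfolding ceq_def cyclic_tensor_def presentation.simps by (intro fspan_base UnI2) blast
qed

lemma (in k_submodule) multibalanced_rels:
  assumes f: "multibalanced s S C X n f" and a: "a \<in> rels (cyclic_tensor C X n)"
  shows "linext s f a \<in> S"
proof -
  consider (mid) as bs x \<rho> where "a = push (\<lambda>(c, c'). (as @ [c, c'] @ bs, x)) \<rho>"
      "length as + length bs + 1 = n" "\<rho> \<in> tensor_rels C C"
    | (last) as \<rho> where "a = push (\<lambda>(c, x). (as @ [c], x)) \<rho>" "length as = n" "\<rho> \<in> tensor_rels C X"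
    | (cyc) r c cs x where "a = monom (lact C r c # cs, x) - monom (c # cs, ract X x r)" "length cs = n"
    using a by (auto simp: cyclic_tensor_def)
  then show ?thesis
  proof cases
    case mid
    have "linear_mod (scale C) s S (\<lambda>c'. f (as @ c # c' # bs, x))" for c
      using multibalancedD(1)[OF f, of "as @ [c]" bs x] mid(2) by simp
    then have "balanced s S C C (\<lambda>c c'. f (as @ c # c' # bs, x))"
      using multibalancedD(1)[OF f, of as "c' # bs" x for c'] multibalancedD(3)[OF f] mid(2)
      by (intro balancedI) auto
    from balanced_rels[OF this mid(3)] show ?thesis
      by (simp add: mid(1) linext_push case_prod_unfold)
  next
    case last
    have "balanced s S C X (\<lambda>c x. f (as @ [c], x))"
      using multibalancedD(1)[OF f, of as "[]"] multibalancedD(2,4)[OF f] last(2)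
      by (intro balancedI) auto
    from balanced_rels[OF this last(3)] show ?thesis
      by (simp add: last(1) linext_push case_prod_unfold)
  next
    case cyc
    then show ?thesis using f by (simp add: multibalanced_def linext_diff ceq_def)
  qed
qed

lemma multibalanced_descends:
  assumes "multibalanced fscale (fspan A) C X n f"
  shows "descends (cyclic_tensor C X n) (fspan A) f"
  unfolding descends_def
  using span.multibalanced_rels[OF assms] by (auto intro: span.ceq_linext_fspan)

text \<open>The inner sum of \<open>Z_degen\<close> written in the free module; as it uses a chosen
  representative of \<open>\<Delta>\<close>, only its class has a meaning.\<close>

definition degen_word ::
  "('c \<Rightarrow> ('c \<times> 'c \<Rightarrow>\<^sub>0 'k::{comm_ring, comm_monoid_mult}) set) \<Rightarrow> nat \<Rightarrow> 'c list \<times> 'x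
    \<Rightarrow> ('c list \<times> 'x \<Rightarrow>\<^sub>0 'k)" where
  "degen_word \<Delta> k = (\<lambda>(cs, x).
     fext (\<lambda>(c1, c2). monom (take k cs @ c1 # c2 # drop (k + 1) cs, x)) (rep (\<Delta> (cs ! k))))"

lemma degen_word_split:
  assumes "length as = k"
  shows "degen_word \<Delta> k (as @ c # bs, x) = fext (\<lambda>(c1, c2). monom (as @ c1 # c2 # bs, x)) (rep (\<Delta> c))"
  using assms by (auto simp: degen_word_def nth_append)

section \<open>Faces and degeneracies are well defined\<close>

context coring_and_bimodule
begin

abbreviation zeq where "zeq n \<equiv> ceq (rspan (cyclic_tensor C X n))"

abbreviation zlinear where "zlinear t n \<equiv> linear_mod t fscale (rspan (cyclic_tensor C X n))"

lemmas zlinear_slot = multibalancedD(1)[OF multibalanced_monom[of C X]]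
  and zlinear_last = multibalancedD(2)[OF multibalanced_monom[of C X]]
  and zeq_mid = multibalancedD(3)[OF multibalanced_monom[of C X]]
  and zeq_last = multibalancedD(4)[OF multibalanced_monom[of C X]]
  and zeq_cyc = multibalancedD(5)[OF multibalanced_monom[of C X]]

lemma face_split:
  "length as = k \<Longrightarrow> face_word C \<epsilon> X k (as @ c # bs, x) = act_tail C X as (\<epsilon> c) bs x"
  by (rule face_word_split)

lemma degen_split:
  fixes x :: 'x
  shows "length as = k \<Longrightarrow> degen_word \<Delta> k (as @ c # bs, x) = fext (\<lambda>(c1, c2). monom (as @ c1 # c2 # bs, x)) (C.D c)"
  by (rule degen_word_split)

lemmas balanced_Z = balanced_cyclic[where C = C and X = X]

lemma zlinear_act_slot:
  assumes "length as + length bs + length es = n"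
  shows "zlinear (scale C) n (\<lambda>c. monom (act_tail C X (as @ c # bs) r es x))"
proof (cases es)
  case Nil
  then show ?thesis using zlinear_slot assms by simp
next
  case (Cons e es')
  then show ?thesis using zlinear_slot[of as "bs @ lact C r e # es'"] assms by simp
qed

lemma zlinear_act:
  assumes "length as + length bs = n + 1"
  shows "zlinear sR n (\<lambda>r. monom (act_tail C X as r bs x))"
proof (cases bs)
  case Nil
  then show ?thesis using linear_mod_comp[OF zlinear_last X.lact_linear_ring] assms by simp
next
  case (Cons b bs')
  then show ?thesis using linear_mod_comp[OF zlinear_slot C.lact_linear_ring] assms by simp
qed

lemma zlinear_act_last:
  assumes "length as + length bs = n + 1"
  shows "zlinear (scale X) n (\<lambda>x. monom (act_tail C X as r bs x))"
proof (cases bs)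
  case Nil
  then show ?thesis using linear_mod_comp[OF zlinear_last X.lact_linear] assms by simp
next
  case (Cons b bs')
  then show ?thesis using zlinear_last[of "as @ lact C r b # bs'"] assms by simp
qed

text \<open>Handles a relation whose right-hand letter is consumed by the face: there
  \<open>\<epsilon> (r \<cdot> c') = r * \<epsilon> c'\<close> acts on the tail, and
  \<open>r\<close> has to return across the tensor sign.\<close>

lemma zeq_act:
  assumes "length as + length bs = n"
  shows "zeq n (monom (act_tail C X (as @ [ract C c r]) r' bs x)) (monom (act_tail C X (as @ [c]) (r * r') bs x))"
proof (cases bs)
  case Nil
  then show ?thesis using zeq_last assms by (simp add: X.lact_mult)
next
  case (Cons b bs')
  then show ?thesis using zeq_mid assms by (simp add: C.lact_mult)
qed

text \<open>For each of the five conditions, \<open>k\<close> is compared with the slots involved.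
  Away from them the face leaves the relation intact; next to them bilinearity of
  \<open>\<epsilon>\<close>, associativity of the actions or the commuting of left and right actions
  is needed.\<close>

lemma multibalanced_face:
  assumes "k \<le> n + 1"
  shows "multibalanced fscale (rspan (cyclic_tensor C X n)) C X (n + 1) (\<lambda>w. monom (face_word C \<epsilon> X k w))"
  unfolding multibalanced_def
proof (intro conjI allI impI)
  fix as bs :: "'c list" and x assume len: "length as + length bs = n + 1"
  then have "k < length as + length bs + 1" using assms by simp
  then show "zlinear (scale C) n (\<lambda>c. monom (face_word C \<epsilon> X k (as @ c # bs, x)))"
  proof (cases rule: split_nth_cases)
    case (before as1 d as2)
    show ?thesis
    proof (cases as2)
      case Nil
      then show ?thesis using before len linear_mod_comp[OF zlinear_slot C.lact_linear]
        by (simp add: face_split)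
    next
      case (Cons e as3)
      then show ?thesis using before len zlinear_slot[of "as1 @ lact C (\<epsilon> d) e # as3"]
        by (simp add: face_split)
    qed
  next
    case at
    then show ?thesis using linear_mod_comp[OF zlinear_act C.counit_linear] len
      by (simp add: face_split)
  next
    case (after bs1 d bs2)
    then show ?thesis using face_split[of "as @ c # bs1" k for c] zlinear_act_slot len by simp
  qed
next
  fix cs :: "'c list" assume len: "length cs = n + 1 + 1"
  then obtain as c bs where "cs = as @ c # bs" "length as = k" using assms split_nth[of k cs] by auto
  then show "zlinear (scale X) n (\<lambda>x. monom (face_word C \<epsilon> X k (cs, x)))"
    using zlinear_act_last len by (simp add: face_split)
next
  fix as bs :: "'c list" and c r c' x assume len: "length as + length bs + 1 = n + 1"
  then have "k < length as + length (c' # bs) + 1" using assms by simp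
  then show "zeq n (monom (face_word C \<epsilon> X k (as @ ract C c r # c' # bs, x)))
      (monom (face_word C \<epsilon> X k (as @ c # lact C r c' # bs, x)))"
  proof (cases rule: split_nth_cases)
    case (before as1 d as2)
    show ?thesis
    \<comment> \<open>With \<open>as2\<close> empty, \<open>\<epsilon> d\<close> lands on the letter
      that carries the right action, and the two actions commute.\<close>
    proof (cases as2)
      case Nil
      then show ?thesis using before len zeq_mid by (simp add: face_split C.lact_ract)
    next
      case (Cons e as3)
      then show ?thesis using before len zeq_mid[of "as1 @ lact C (\<epsilon> d) e # as3"]
        by (simp add: face_split)
    qed
  next
    case at
    then show ?thesis by (simp add: face_split C.lact_mult)
  next
    case (after bs1 d bs2)
    show ?thesis
    proof (cases bs1)
      case Nil
      then show ?thesis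
        using after face_split[of "as @ [c]" k for c] zeq_act len by simp
    next
      case (Cons e bs3)
      then show ?thesis
        using after face_split[of "as @ c # c' # bs3" k for c c'] zeq_mid len by (cases bs2) auto
    qed
  qed
next
  fix as :: "'c list" and c r x assume len: "length as = n + 1"
  then have "k < length as + length [] + 1" using assms by simp
  then show "zeq n (monom (face_word C \<epsilon> X k (as @ [ract C c r], x)))
      (monom (face_word C \<epsilon> X k (as @ [c], lact X r x)))"
  proof (cases rule: split_nth_cases)
    case (before as1 d as2)
    \<comment> \<open>The prefix is written with \<open>hd\<close> and \<open>tl\<close> so that a
      single instance can be supplied before the case split on \<open>as2\<close>.\<close>
    then show ?thesis using zeq_last[of "as1 @ lact C (\<epsilon> d) (hd as2) # tl as2"] zeq_last[of as1] len
      by (cases as2) (simp_all add: face_split C.lact_ract)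
  next
    case at
    then show ?thesis by (simp add: face_split X.lact_mult)
  qed simp
next
  fix c r and cs :: "'c list" and x assume len: "length cs = n + 1"
  show "zeq n (monom (face_word C \<epsilon> X k (lact C r c # cs, x)))
      (monom (face_word C \<epsilon> X k (c # cs, ract X x r)))"
  proof (cases k)
    case 0
    \<comment> \<open>The source has degree \<open>n + 1\<close>, so \<open>cs\<close> is nonempty:
      \<open>r * \<epsilon> c\<close> acts on its head, and the cyclic relation carries
      \<open>r\<close> over to \<open>x\<close>.\<close>
    then show ?thesis using face_split[of "[]" k] len zeq_cyc
      by (cases cs) (simp_all add: C.lact_mult)
  next
    case (Suc k')
    then obtain es d gs where "cs = es @ d # gs" "length es = k'" using assms len split_nth[of k' cs] by auto
    \<comment> \<open>If \<open>gs\<close> is empty, \<open>\<epsilon> d\<close> acts on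
      \<open>x\<close> itself and commutes with the right action of \<open>r\<close>.\<close>
    then show ?thesis using face_split[of "c # es" k for c] len zeq_cyc Suc
      by (cases gs) (simp_all add: X.lact_ract)
  qed
qed

text \<open>When the split letter takes part in a relation, bilinearity of \<open>\<Delta>\<close>
  puts the scalar on the outer leg of \<open>c1 \<otimes> c2\<close>, which is the leg adjacent to
  the tensor sign in question.\<close>

lemma multibalanced_degen:
  assumes "k \<le> n"
  shows "multibalanced fscale (rspan (cyclic_tensor C X (n + 1))) C X n (degen_word \<Delta> k)"
  unfolding multibalanced_def
proof (intro conjI allI impI)
  fix as bs :: "'c list" and x assume len: "length as + length bs = n"
  then have "k < length as + length bs + 1" using assms by simp
  then show "zlinear (scale C) (n + 1) (\<lambda>c. degen_word \<Delta> k (as @ c # bs, x))"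
  proof (cases rule: split_nth_cases)
    case (before as1 d as2)
    then show ?thesis using len zlinear_slot[of "as1 @ d1 # d2 # as2" for d1 d2]
      by (auto simp: degen_split intro!: span.linear_mod_linext2)
  next
    case at
    then show ?thesis using C.linear_mod_comult[OF balanced_Z(1)] len
      by (simp add: degen_split)
  next
    case (after bs1 d bs2)
    then show ?thesis using len degen_split[of "as @ c # bs1" k for c] zlinear_slot
      by (auto intro!: span.linear_mod_linext2)
  qed
next
  fix cs :: "'c list" assume len: "length cs = n + 1"
  then obtain as c bs where "cs = as @ c # bs" "length as = k" using assms split_nth[of k cs] by auto
  then show "zlinear (scale X) (n + 1) (\<lambda>x. degen_word \<Delta> k (cs, x))"
    using zlinear_last len by (auto simp: degen_split intro!: span.linear_mod_linext2)
next
  fix as bs :: "'c list" and c r c' x assume len: "length as + length bs + 1 = n"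
  then have "k < length as + length (c' # bs) + 1" using assms by simp
  then show "zeq (n + 1) (degen_word \<Delta> k (as @ ract C c r # c' # bs, x))
      (degen_word \<Delta> k (as @ c # lact C r c' # bs, x))"
  proof (cases rule: split_nth_cases)
    case (before as1 d as2)
    then show ?thesis using len zeq_mid[of "as1 @ d1 # d2 # as2" for d1 d2]
      by (auto simp: degen_split intro!: span.ceq_linext2)
  next
    case at
    note C.ceq_comult_ract[OF balanced_Z(1), of as "c' # bs" "n + 1" x c r]
    also have "zeq (n + 1) (fext (\<lambda>(c1, c2). monom (as @ c1 # ract C c2 r # c' # bs, x)) (rep (\<Delta> c)))
        (fext (\<lambda>(c1, c2). monom (as @ c1 # c2 # lact C r c' # bs, x)) (rep (\<Delta> c)))"
      using len zeq_mid[of "as @ [c1]" for c1] by (auto intro!: span.ceq_linext2)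
    finally show ?thesis using at len by (simp add: degen_split)
  next
    case (after bs1 d bs2)
    show ?thesis
    proof (cases bs1)
      case Nil
      have "zeq (n + 1) (fext (\<lambda>(c1, c2). monom (as @ ract C c r # c1 # c2 # bs, x)) (rep (\<Delta> c')))
          (fext (\<lambda>(c1, c2). monom (as @ c # lact C r c1 # c2 # bs, x)) (rep (\<Delta> c')))"
        using len zeq_mid by (auto intro!: span.ceq_linext2)
      \<comment> \<open>Left linearity of \<open>\<Delta>\<close>, read backwards.\<close>
      also have "zeq (n + 1) \<dots> (fext (\<lambda>(c1, c2). monom (as @ c # c1 # c2 # bs, x)) (rep (\<Delta> (lact C r c'))))"
        using C.ceq_comult_lact[OF balanced_Z(1), of "as @ [c]" bs "n + 1" x r c'] len
        by (auto intro: span.ceq_sym)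
      finally show ?thesis
        using Nil after degen_split[of "as @ [c]" k for c] by simp
    next
      case (Cons e bs3)
      then show ?thesis
        using after degen_split[of "as @ c # c' # bs3" k for c c'] zeq_mid len
        by (auto intro!: span.ceq_linext2)
    qed
  qed
next
  fix as :: "'c list" and c r x assume len: "length as = n"
  then have "k < length as + length [] + 1" using assms by simp
  then show "zeq (n + 1) (degen_word \<Delta> k (as @ [ract C c r], x)) (degen_word \<Delta> k (as @ [c], lact X r x))"
  proof (cases rule: split_nth_cases)
    case (before as1 d as2)
    then show ?thesis using zeq_last[of "as1 @ d1 # d2 # as2" for d1 d2] len
      by (auto simp: degen_split intro!: span.ceq_linext2)
  next
    case at
    note C.ceq_comult_ract[OF balanced_Z(1), of as "[]" "n + 1" x c r]
    also have "zeq (n + 1) (fext (\<lambda>(c1, c2). monom (as @ [c1, ract C c2 r], x)) (rep (\<Delta> c)))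
        (fext (\<lambda>(c1, c2). monom (as @ [c1, c2], lact X r x)) (rep (\<Delta> c)))"
      using len zeq_last[of "as @ [c1]" for c1] by (auto intro!: span.ceq_linext2)
    finally show ?thesis using at len by (simp add: degen_split)
  qed simp
next
  fix c r and cs :: "'c list" and x assume len: "length cs = n"
  show "zeq (n + 1) (degen_word \<Delta> k (lact C r c # cs, x)) (degen_word \<Delta> k (c # cs, ract X x r))"
  proof (cases k)
    case 0
    note C.ceq_comult_lact[OF balanced_Z(1), of "[]" cs "n + 1" x r c]
    also have "zeq (n + 1) (fext (\<lambda>(c1, c2). monom ([] @ lact C r c1 # c2 # cs, x)) (rep (\<Delta> c)))
        (fext (\<lambda>(c1, c2). monom ([] @ c1 # c2 # cs, ract X x r)) (rep (\<Delta> c)))"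
      using len zeq_cyc by (auto intro!: span.ceq_linext2)
    finally show ?thesis using 0 len degen_split[of "[]" k] by simp
  next
    case (Suc k')
    then obtain es d gs where "cs = es @ d # gs" "length es = k'" using assms len split_nth[of k' cs] by auto
    then show ?thesis using degen_split[of "c # es" k for c] len zeq_cyc Suc
      by (auto intro!: span.ceq_linext2)
  qed
qed

lemma induces_face:
  assumes "1 \<le> n" "k \<le> n"
  shows "induces (cyclic_tensor C X n) (cyclic_tensor C X (n - 1)) (Z_face C \<epsilon> X n k)
    (\<lambda>w. monom (face_word C \<epsilon> X k w))"
  unfolding Z_face_def[abs_def] gen_def
  using multibalanced_descends[OF multibalanced_face[of k "n - 1"]] assms by (intro induces_psum) simp

lemma induces_degen:
  assumes "k \<le> n"
  shows "induces (cyclic_tensor C X n) (cyclic_tensor C X (n + 1)) (Z_degen C \<Delta> X n k) (degen_word \<Delta> k)"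
proof -
  have "(\<lambda>(cs, x). psum Q (\<Delta> (cs ! k)) (\<lambda>(c1, c2). gen Q (take k cs @ [c1, c2] @ drop (k + 1) cs, x)))
      = (\<lambda>w. coset Q (degen_word \<Delta> k w))" for Q :: "('c list \<times> 'x, 'k) presentation"
    by (auto simp: fun_eq_iff degen_word_def psum_gen2)
  then have "Z_degen C \<Delta> X n k =
      (\<lambda>z. psum (cyclic_tensor C X (n + 1)) z (\<lambda>w. coset (cyclic_tensor C X (n + 1)) (degen_word \<Delta> k w)))"
    by (simp only: Z_degen_def[abs_def])
  then show ?thesis
    using induces_psum[OF multibalanced_descends[OF multibalanced_degen[OF assms]]] by simp
qed

section \<open>Simplicial identities on words\<close>

lemma face_face:
  assumes "i < j" "j < length cs"
  shows "face_word C \<epsilon> X i (face_word C \<epsilon> X j (cs, x)) =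
    face_word C \<epsilon> X (j - 1) (face_word C \<epsilon> X i (cs, x))"
proof -
  obtain as c bs d es where cs: "cs = as @ c # bs @ d # es"
    and i: "length as = i" and j: "length as + length bs + 1 = j"
    using assms by (rule split_nth2)
  have 1: "face_word C \<epsilon> X j (cs, x) = act_tail C X (as @ c # bs) (\<epsilon> d) es x"
    using cs j face_split[of "as @ c # bs" j] by simp
  have 2: "face_word C \<epsilon> X i (cs, x) = act_tail C X as (\<epsilon> c) (bs @ d # es) x"
    using cs i by (simp add: face_split)
  show ?thesis
  \<comment> \<open>Only adjacent letters interact: both sides then apply
    \<open>\<epsilon> c * \<epsilon> d\<close> to the tail.\<close>
  proof (cases bs)
    case Nil
    then show ?thesis unfolding 1 2 using i j
      by (cases es) (simp_all add: face_split C.lact_mult X.lact_mult)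
  next
    case (Cons b bs')
    then show ?thesis unfolding 1 2 using i j face_split[of "as @ lact C (\<epsilon> c) b # bs'" "j - 1"]
      by (cases es) (simp_all add: face_split)
  qed
qed

text \<open>For \<open>i = j\<close> this is coassociativity inside the word; for
  \<open>i < j\<close> the two sums are independent and merely change order.\<close>

lemma degen_degen:
  assumes "i \<le> j" "length cs = n + 1" "j \<le> n"
  shows "zeq (n + 2) (fext (degen_word \<Delta> i) (degen_word \<Delta> j (cs, x)))
     (fext (degen_word \<Delta> (j + 1)) (degen_word \<Delta> i (cs, x)))"
proof (cases "i = j")
  case True
  obtain as c bs where cs: "cs = as @ c # bs" and i: "length as = i"
    using split_nth[of i cs] assms True by auto
  have "zeq (n + 2) (fext (\<lambda>(c1, c2). fext (\<lambda>(c11, c12). monom (as @ c11 # c12 # c2 # bs, x)) (C.D c1)) (C.D c))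
     (fext (\<lambda>(c1, c2). fext (\<lambda>(c21, c22). monom (as @ c1 # c21 # c22 # bs, x)) (C.D c2)) (C.D c))"
    using span.ceq_linext_trilinear[OF _ _ C.coassoc_rep[of c],
        where f = "\<lambda>c1 c2 c3. monom (as @ c1 # c2 # c3 # bs, x)"]
      balanced_Z(1)[of as "c3 # bs" "n + 2" x for c3] balanced_Z(1)[of "as @ [c1]" bs "n + 2" x for c1]
      cs assms by (simp add: free.linext_fext case_prod_unfold)
  then show ?thesis
    using True cs i degen_split[of "as @ [c1]" "j + 1" for c1]
    by (simp add: degen_split free.linext_fext case_prod_unfold)
next
  case False
  then have "i < j" "j < length cs" using assms by auto
  then obtain as c bs d es where cs: "cs = as @ c # bs @ d # es"
    and i: "length as = i" and j: "length as + length bs + 1 = j"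
    by (rule split_nth2)
  have "degen_word \<Delta> j (cs, x) = fext (\<lambda>(d1, d2). monom (as @ c # bs @ d1 # d2 # es, x)) (C.D d)"
    using cs j degen_split[of "as @ c # bs" j] by simp
  then have "fext (degen_word \<Delta> i) (degen_word \<Delta> j (cs, x)) =
      fext (\<lambda>(d1, d2). fext (\<lambda>(c1, c2). monom (as @ c1 # c2 # bs @ d1 # d2 # es, x)) (C.D c)) (C.D d)"
    using i by (simp add: free.linext_fext degen_split case_prod_unfold)
  also have "\<dots> =
      fext (\<lambda>(c1, c2). fext (\<lambda>(d1, d2). monom (as @ c1 # c2 # bs @ d1 # d2 # es, x)) (C.D d)) (C.D c)"
    unfolding case_prod_unfold by (rule free.linext_swap)
  also have "\<dots> = fext (degen_word \<Delta> (j + 1)) (degen_word \<Delta> i (cs, x))"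
    using cs i j degen_split[of "as @ c1 # c2 # bs" "j + 1" for c1 c2]
    by (simp add: free.linext_fext degen_split case_prod_unfold)
  finally show ?thesis by simp
qed

abbreviation face where "face k \<equiv> (\<lambda>w. monom (face_word C \<epsilon> X k w))"

text \<open>The face interferes with the split letter only if it is the right neighbour; then
  \<open>\<epsilon> c\<close> passes through \<open>\<Delta>\<close> by left linearity.\<close>

lemma face_degen_before:
  assumes "i < j" "length cs = n + 1" "j \<le> n"
  shows "zeq n (fext (face i) (degen_word \<Delta> j (cs, x))) (degen_word \<Delta> (j - 1) (face_word C \<epsilon> X i (cs, x)))"
proof -
  have "i < j" "j < length cs" using assms by auto
  then obtain as c bs d es where cs: "cs = as @ c # bs @ d # es"
    and i: "length as = i" and j: "length as + length bs + 1 = j"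
    by (rule split_nth2)
  have 1: "fext (face i) (degen_word \<Delta> j (cs, x)) =
      fext (\<lambda>(d1, d2). monom (act_tail C X as (\<epsilon> c) (bs @ d1 # d2 # es) x)) (C.D d)"
    using cs i j degen_split[of "as @ c # bs" j] by (simp add: free.linext_fext face_split case_prod_unfold)
  have 2: "face_word C \<epsilon> X i (cs, x) = act_tail C X as (\<epsilon> c) (bs @ d # es) x"
    using cs i by (simp add: face_split)
  show ?thesis
  proof (cases bs)
    case Nil
    then show ?thesis unfolding 1 2
      using C.ceq_comult_lact[OF balanced_Z(1), of as es n x "\<epsilon> c" d] assms cs i j
      by (simp add: degen_split span.ceq_sym)
  next
    case (Cons b bs')
    then show ?thesis unfolding 1 2
      using i j degen_split[of "as @ lact C (\<epsilon> c) b # bs'" "j - 1"] by simp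
  qed
qed

text \<open>Counits are absorbed to the right, hence never reach the two new letters on their left;
  this gives an equality in the free module.\<close>

lemma face_degen_after:
  assumes "j + 1 < i" "length cs = n + 1" "i \<le> n + 1"
  shows "fext (face i) (degen_word \<Delta> j (cs, x)) = degen_word \<Delta> j (face_word C \<epsilon> X (i - 1) (cs, x))"
proof -
  have "j < i - 1" "i - 1 < length cs" using assms by auto
  then obtain as c bs d es where cs: "cs = as @ c # bs @ d # es"
    and j: "length as = j" and i: "length as + length bs + 1 = i - 1"
    by (rule split_nth2)
  have "face_word C \<epsilon> X i (as @ c1 # c2 # bs @ d # es, x) = act_tail C X (as @ c1 # c2 # bs) (\<epsilon> d) es x" for c1 c2
    using i assms(1) face_split[of "as @ c1 # c2 # bs" i] by simp
  moreover have "face_word C \<epsilon> X (i - 1) (cs, x) = act_tail C X (as @ c # bs) (\<epsilon> d) es x"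
    using cs i face_split[of "as @ c # bs" "i - 1"] by simp
  ultimately show ?thesis
    using cs j by (cases es) (simp_all add: degen_split free.linext_fext case_prod_unfold)
qed

lemma face_degen_same:
  assumes "length cs = n + 1" "j \<le> n"
  shows "zeq n (fext (face j) (degen_word \<Delta> j (cs, x))) (monom (cs, x))"
    and "zeq n (fext (face (j + 1)) (degen_word \<Delta> j (cs, x))) (monom (cs, x))"
proof -
  obtain as c bs where cs: "cs = as @ c # bs" and j: "length as = j"
    using split_nth[of j cs] assms by auto
  have lin: "zlinear (scale C) n (\<lambda>c. monom (as @ c # bs, x))"
    using zlinear_slot cs assms by simp
  have "fext (face j) (degen_word \<Delta> j (cs, x)) =
      fext (\<lambda>(c1, c2). monom (as @ lact C (\<epsilon> c1) c2 # bs, x)) (C.D c)"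
    using cs j by (simp add: degen_split face_split free.linext_fext case_prod_unfold)
  also have "zeq n \<dots> (monom (as @ linext (scale C) (\<lambda>(c1, c2). lact C (\<epsilon> c1) c2) (C.D c) # bs, x))"
    by (rule span.ceq_linext_map2[OF lin])
  finally show "zeq n (fext (face j) (degen_word \<Delta> j (cs, x))) (monom (cs, x))"
    using C.counit_left_rep cs by simp
  have "fext (face (j + 1)) (degen_word \<Delta> j (cs, x)) =
      fext (\<lambda>(c1, c2). monom (act_tail C X (as @ [c1]) (\<epsilon> c2) bs x)) (C.D c)"
    using cs j face_split[of "as @ [c1]" "j + 1" for c1]
    by (simp add: degen_split free.linext_fext case_prod_unfold)
  \<comment> \<open>The face makes \<open>\<epsilon> c2\<close> act to the right; a tensor relation
    brings it back onto \<open>c1\<close>, where the right counit axiom applies.\<close>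
  also have "zeq n \<dots> (fext (\<lambda>(c1, c2). monom (as @ ract C c1 (\<epsilon> c2) # bs, x)) (C.D c))"
  proof (rule span.ceq_linext2, rule span.ceq_sym)
    fix c1 c2
    show "zeq n (monom (as @ ract C c1 (\<epsilon> c2) # bs, x)) (monom (act_tail C X (as @ [c1]) (\<epsilon> c2) bs x))"
      using cs assms zeq_last zeq_mid by (cases bs) simp_all
  qed
  also have "zeq n \<dots> (monom (as @ linext (scale C) (\<lambda>(c1, c2). ract C c1 (\<epsilon> c2)) (C.D c) # bs, x))"
    by (rule span.ceq_linext_map2[OF lin])
  finally show "zeq n (fext (face (j + 1)) (degen_word \<Delta> j (cs, x))) (monom (cs, x))"
    using C.counit_right_rep cs by simp
qed

lemma gens_cyclic [simp]: "gens (cyclic_tensor C X n) = {w. length (fst w) = n + 1}"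
  by (auto simp: cyclic_tensor_def)

lemma keys_monom: "Poly_Mapping.keys (monom w) \<subseteq> {w}"
  by (simp add: monom_def)

lemma length_face_word:
  assumes "k < length (fst w)" shows "length (fst (face_word C \<epsilon> X k w)) = length (fst w) - 1"
  using assms by (auto simp: face_word_def case_prod_unfold)

lemma keys_face:
  assumes "k \<le> n" "1 \<le> n" "w \<in> gens (cyclic_tensor C X n)"
  shows "Poly_Mapping.keys (face k w) \<subseteq> gens (cyclic_tensor C X (n - 1))"
  using keys_monom[of "face_word C \<epsilon> X k w"] length_face_word[of k w] assms by fastforce

lemma keys_fext_monom2:
  assumes "\<And>v w. g v w \<in> A" shows "Poly_Mapping.keys (fext (\<lambda>(v, w). monom (g v w)) p) \<subseteq> A"
  using keys_fext[of "\<lambda>(v, w). monom (g v w)" p] keys_monom assms by fastforce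

lemma keys_degen:
  assumes "k \<le> n" "w \<in> gens (cyclic_tensor C X n)"
  shows "Poly_Mapping.keys (degen_word \<Delta> k w) \<subseteq> gens (cyclic_tensor C X (n + 1))"
proof (cases w)
  case (Pair cs x)
  have "Poly_Mapping.keys (fext (\<lambda>(c1, c2). monom (take k cs @ c1 # c2 # drop (k + 1) cs, x)) (C.D (cs ! k)))
      \<subseteq> gens (cyclic_tensor C X (n + 1))"
    using assms Pair by (intro keys_fext_monom2) auto
  then show ?thesis by (simp add: Pair degen_word_def)
qed

theorem simplicial_module_cyclic:
  "simplicial_module (cyclic_tensor C X) (Z_face C \<epsilon> X) (Z_degen C \<Delta> X)"
  unfolding simplicial_module_def
proof (intro conjI allI ballI impI)
  show "phom (cyclic_tensor C X n) (cyclic_tensor C X (n - 1)) (Z_face C \<epsilon> X n k)" if "1 \<le> n" "k \<le> n" for n k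
    using phom_induces[OF induces_face] keys_face that by blast
  show "phom (cyclic_tensor C X n) (cyclic_tensor C X (n + 1)) (Z_degen C \<Delta> X n k)" if "k \<le> n" for n k
    using phom_induces[OF induces_degen] keys_degen that by blast
next
  fix n i j z assume *: "2 \<le> n" "j \<le> n" "i < j" and z: "z \<in> pcarrier (cyclic_tensor C X n)"
  have 1: "induces (cyclic_tensor C X n) (cyclic_tensor C X (n - 1 - 1))
      (\<lambda>z. Z_face C \<epsilon> X (n - 1) k (Z_face C \<epsilon> X n l z)) (\<lambda>w. monom (face_word C \<epsilon> X k (face_word C \<epsilon> X l w)))"
    if "k \<le> n - 1" "l \<le> n" for k l
    using induces_comp[OF induces_face[of n l] induces_face[of "n - 1" k]] * that by simp
  show "Z_face C \<epsilon> X (n - 1) i (Z_face C \<epsilon> X n j z) = Z_face C \<epsilon> X (n - 1) (j - 1) (Z_face C \<epsilon> X n i z)"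
    by (rule induces_eq[OF 1 1 _ z]) (use * face_face[of i j] in auto)
next
  fix n i j z assume *: "j \<le> n" "i \<le> j" and z: "z \<in> pcarrier (cyclic_tensor C X n)"
  have 1: "induces (cyclic_tensor C X n) (cyclic_tensor C X (n + 1 + 1))
      (\<lambda>z. Z_degen C \<Delta> X (n + 1) k (Z_degen C \<Delta> X n l z)) (\<lambda>w. fext (degen_word \<Delta> k) (degen_word \<Delta> l w))"
    if "k \<le> n + 1" "l \<le> n" for k l
    using induces_comp[OF induces_degen[of l n] induces_degen[of k "n + 1"]] that by simp
  show "Z_degen C \<Delta> X (n + 1) i (Z_degen C \<Delta> X n j z) = Z_degen C \<Delta> X (n + 1) (j + 1) (Z_degen C \<Delta> X n i z)"
    by (rule induces_eq[OF 1 1 _ z]) (use * degen_degen[of i j _ n] in auto)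
next
  fix n i j z assume *: "j \<le> n" "i < j" and z: "z \<in> pcarrier (cyclic_tensor C X n)"
  have 1: "induces (cyclic_tensor C X n) (cyclic_tensor C X n)
      (\<lambda>z. Z_face C \<epsilon> X (n + 1) i (Z_degen C \<Delta> X n j z)) (\<lambda>w. fext (face i) (degen_word \<Delta> j w))"
    using induces_comp[OF induces_degen induces_face[of "n + 1" i]] * by simp
  have 2: "induces (cyclic_tensor C X n) (cyclic_tensor C X n)
      (\<lambda>z. Z_degen C \<Delta> X (n - 1) (j - 1) (Z_face C \<epsilon> X n i z)) (\<lambda>w. degen_word \<Delta> (j - 1) (face_word C \<epsilon> X i w))"
    using induces_comp[OF induces_face induces_degen[of "j - 1" "n - 1"]] * by simp
  show "Z_face C \<epsilon> X (n + 1) i (Z_degen C \<Delta> X n j z) = Z_degen C \<Delta> X (n - 1) (j - 1) (Z_face C \<epsilon> X n i z)"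
    by (rule induces_eq[OF 1 2 _ z]) (use * face_degen_before in auto)
next
  fix n j z assume *: "j \<le> n" and z: "z \<in> pcarrier (cyclic_tensor C X n)"
  have 1: "induces (cyclic_tensor C X n) (cyclic_tensor C X n)
      (\<lambda>z. Z_face C \<epsilon> X (n + 1) i (Z_degen C \<Delta> X n j z)) (\<lambda>w. fext (face i) (degen_word \<Delta> j w))"
    if "i \<le> n + 1" for i
    using induces_comp[OF induces_degen induces_face[of "n + 1" i]] * that by simp
  show "Z_face C \<epsilon> X (n + 1) j (Z_degen C \<Delta> X n j z) = z"
    "Z_face C \<epsilon> X (n + 1) (j + 1) (Z_degen C \<Delta> X n j z) = z"
    by (rule induces_eq[OF 1 induces_id _ z]; use * face_degen_same in auto)+
next
  fix n i j z assume *: "j \<le> n" "i \<le> n + 1" "j + 1 < i" and z: "z \<in> pcarrier (cyclic_tensor C X n)"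
  have 1: "induces (cyclic_tensor C X n) (cyclic_tensor C X n)
      (\<lambda>z. Z_face C \<epsilon> X (n + 1) i (Z_degen C \<Delta> X n j z)) (\<lambda>w. fext (face i) (degen_word \<Delta> j w))"
    using induces_comp[OF induces_degen induces_face[of "n + 1" i]] * by simp
  have 2: "induces (cyclic_tensor C X n) (cyclic_tensor C X n)
      (\<lambda>z. Z_degen C \<Delta> X (n - 1) j (Z_face C \<epsilon> X n (i - 1) z)) (\<lambda>w. degen_word \<Delta> j (face_word C \<epsilon> X (i - 1) w))"
    using induces_comp[OF induces_face induces_degen[of j "n - 1"]] * by simp
  show "Z_face C \<epsilon> X (n + 1) i (Z_degen C \<Delta> X n j z) = Z_degen C \<Delta> X (n - 1) j (Z_face C \<epsilon> X n (i - 1) z)"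
    by (rule induces_eq[OF 1 2 _ z]) (use * face_degen_after in auto)
qed

end


section \<open>Comodules over a bialgebroid\<close>

lemma base_bimod_simps [simp]:
  "scale (base_bimod sB \<xi> \<zeta>) = sB" "lact (base_bimod sB \<xi> \<zeta>) r b = \<xi> r * b"
  "ract (base_bimod sB \<xi> \<zeta>) b r = \<zeta> r * b"
  by (simp_all add: base_bimod_def bimod_along_def)

lemma (in k_algebra) k_linear_mult:
  "k_linear s s ((*) a)" "k_linear s s (\<lambda>b. b * a)"
  by (simp_all add: k_linear_def algebra_simps scale_mult_left flip: scale_mult_right)

lemma k_linear_comp: "k_linear t u g \<Longrightarrow> k_linear s t f \<Longrightarrow> k_linear s u (\<lambda>a. g (f a))"
  by (simp add: k_linear_def)

lemma balanced_descends:
  assumes "balanced fscale (fspan A) M N f"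
  shows "descends (tensor2 M N) (fspan A) (\<lambda>(m, n). f m n)"
  using span.ceq_linext_balanced[OF assms] by (simp add: descends_def)

lemma trilinear_descends:
  assumes "\<And>p. balanced fscale (fspan A) M N (\<lambda>m n. f m n p)" "\<And>m. balanced fscale (fspan A) N P (f m)"
  shows "descends (tensor3 M N P) (fspan A) (\<lambda>(m, n, p). f m n p)"
  using span.ceq_linext_trilinear[OF assms] by (simp add: descends_def)

section \<open>Comultiplication and right multiplication by the source map\<close>

context left_bialgebroid
begin

abbreviation Bm where "Bm \<equiv> base_bimod sB \<xi> \<zeta>"

lemma source_target_simps [simp]:
  "\<xi> (r * s) = \<xi> r * \<xi> s" "\<xi> 1 = 1" "\<zeta> (r * s) = \<zeta> s * \<zeta> r" "\<zeta> 1 = 1"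
  "\<epsilon> (\<xi> r * b) = r * \<epsilon> b" "\<epsilon> (\<zeta> r * b) = \<epsilon> b * r"
  using B.counit_lact[of r b] B.counit_ract[of b r]
  by (simp_all add: source_mult source_one target_mult target_one)

lemma k_linear_counit: "k_linear sB sR \<epsilon>"
  using B.counit_linear by simp

text \<open>The right action on \<open>B\<close> is left multiplication by \<open>\<zeta>\<close>,
  which commutes with left multiplication by \<open>\<xi> r\<close>.\<close>

lemma left_mult_source_balanced:
  "balanced fscale (fspan (tensor_rels Bm N)) Bm N (\<lambda>b n. monom (\<xi> r * b, n))"
proof (rule balancedI)
  show "linear_mod (scale Bm) fscale (fspan (tensor_rels Bm N)) (\<lambda>b. monom (\<xi> r * b, n))" for n
    using linear_mod_comp[OF balancedD(1)[OF balanced_monom[of Bm N]], unfolded base_bimod_simps, OF algB.k_linear_mult(1)]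
    by simp
  show "linear_mod (scale N) fscale (fspan (tensor_rels Bm N)) (\<lambda>n. monom (\<xi> r * b, n))" for b
    by (rule balancedD(2)[OF balanced_monom])
  show "ceq (fspan (tensor_rels Bm N)) (monom (\<xi> r * ract Bm b r', n)) (monom (\<xi> r * b, lact N r' n))" for b r' n
    using balancedD(3)[OF balanced_monom[of Bm N], of "\<xi> r * b" r' n]
    by (simp add: mult.assoc[symmetric] source_target_commute)
qed

lemma takeuchi_rep:
  "ceq (fspan (tensor_rels Bm Bm)) (fext (\<lambda>(b1, b2). monom (b1 * \<zeta> r, b2)) (B.D b))
     (fext (\<lambda>(b1, b2). monom (b1, b2 * \<xi> r)) (B.D b))"
  using takeuchi[of b r] by (simp add: psum_gen2 coset_eq_iff)

text \<open>Both actions on \<open>B\<close> are left multiplications, so right multiplications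
  respect the balancing.\<close>

lemma right_mult_balanced:
  "balanced fscale (fspan (tensor_rels Bm Bm)) Bm Bm (\<lambda>b1 b2. monom (b1 * a, b2 * a'))"
proof (rule balancedI)
  note m = balanced_monom[of Bm Bm]
  show "linear_mod (scale Bm) fscale (fspan (tensor_rels Bm Bm)) (\<lambda>b1. monom (b1 * a, b2 * a'))" for b2
    using linear_mod_comp[OF balancedD(1)[OF m], unfolded base_bimod_simps, OF algB.k_linear_mult(2)] by simp
  show "linear_mod (scale Bm) fscale (fspan (tensor_rels Bm Bm)) (\<lambda>b2. monom (b1 * a, b2 * a'))" for b1
    using linear_mod_comp[OF balancedD(2)[OF m], unfolded base_bimod_simps, OF algB.k_linear_mult(2)] by simp
  show "ceq (fspan (tensor_rels Bm Bm)) (monom (ract Bm b1 r * a, b2 * a')) (monom (b1 * a, lact Bm r b2 * a'))" for b1 r b2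
    using balancedD(3)[OF m, of "b1 * a" r "b2 * a'"] by (simp add: mult.assoc)
qed

text \<open>Left linearity and \<open>\<Delta> 1 = 1 \<otimes> 1\<close> give
  \<open>\<Delta> (\<xi> r) = \<xi> r \<otimes> 1\<close>; multiplicativity of
  \<open>\<Delta>\<close> does the rest.\<close>

lemma comult_mult_source:
  "ceq (fspan (tensor_rels Bm Bm)) (B.D (b * \<xi> r)) (fext (\<lambda>(b1, b2). monom (b1 * \<xi> r, b2)) (B.D b))"
proof -
  let ?S = "fspan (tensor_rels Bm Bm)"
  let ?g = "\<lambda>a a'. fext (\<lambda>(b1, b2). monom (b1 * a, b2 * a')) (B.D b)"
  note m = balanced_monom[of Bm Bm]
  \<comment> \<open>Multiplying by \<open>\<Delta> b\<close> from the left is well defined on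
    \<open>B \<otimes> B\<close> because of the Takeuchi condition; this allows
    \<open>\<Delta> (\<xi> r)\<close> to be replaced by \<open>\<xi> r \<otimes> 1\<close>.\<close>
  have g: "balanced fscale ?S Bm Bm ?g"
  proof (rule balancedI)
    show "linear_mod (scale Bm) fscale ?S (\<lambda>a. ?g a a')" for a'
      unfolding base_bimod_simps
      by (rule span.linear_mod_linext2) (rule linear_mod_comp[OF balancedD(1)[OF m], unfolded base_bimod_simps, OF algB.k_linear_mult(1)])
    show "linear_mod (scale Bm) fscale ?S (?g a)" for a
      unfolding base_bimod_simps
      by (rule span.linear_mod_linext2) (rule linear_mod_comp[OF balancedD(2)[OF m], unfolded base_bimod_simps, OF algB.k_linear_mult(1)])
    show "ceq ?S (?g (ract Bm a r) a') (?g a (lact Bm r a'))" for a r a'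
      using span.ceq_linext_balanced[OF right_mult_balanced takeuchi_rep, of a a' r b]
      by (simp add: free.linext_fext case_prod_unfold mult.assoc)
  qed
  have "coset (tensor2 Bm Bm) (B.D 1) = coset (tensor2 Bm Bm) (monom (1, 1))"
    using comult_one B.comult_coset[of 1] by (simp add: gen_def)
  then have "ceq ?S (B.D 1) (monom (1, 1))" by (simp add: coset_eq_iff)
  from span.ceq_linext_balanced[OF left_mult_source_balanced this, of r]
  have "ceq ?S (fext (\<lambda>(b1, b2). monom (\<xi> r * b1, b2)) (B.D 1)) (monom (\<xi> r, 1))" by simp
  with B.comult_lact_rep[of r 1] have \<xi>: "ceq ?S (B.D (\<xi> r)) (monom (\<xi> r, 1))"
    by (auto intro: span.ceq_trans)
  have "coset (tensor2 Bm Bm) (B.D (b * \<xi> r)) = coset (tensor2 Bm Bm)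
      (fext (\<lambda>(b1, b2). fext (\<lambda>(a, a'). monom (b1 * a, b2 * a')) (B.D (\<xi> r))) (B.D b))"
    using comult_mult[of b "\<xi> r"] B.comult_coset[of "b * \<xi> r"] by (simp add: psum_gen2 psum_rep2)
  then have "ceq ?S (B.D (b * \<xi> r))
      (fext (\<lambda>(b1, b2). fext (\<lambda>(a, a'). monom (b1 * a, b2 * a')) (B.D (\<xi> r))) (B.D b))"
    by (simp add: coset_eq_iff)
  \<comment> \<open>The sum over \<open>\<Delta> (\<xi> r)\<close> has to be outermost for the
    balance of \<open>?g\<close> to apply.\<close>
  also have "\<dots> = fext (\<lambda>(a, a'). ?g a a') (B.D (\<xi> r))"
    unfolding case_prod_unfold by (rule free.linext_swap)
  also have "ceq ?S \<dots> (fext (\<lambda>(a, a'). ?g a a') (monom (\<xi> r, 1)))"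
    using g \<xi> by (rule span.ceq_linext_balanced)
  finally show ?thesis by simp
qed

end

section \<open>The two right linearity properties of a coaction\<close>

context left_comodule
begin

abbreviation Rh where "Rh v \<equiv> rep (\<rho> v)"

lemma coaction_linear_mod: "linear_mod (scale V) fscale (fspan (tensor_rels Bm V)) (\<lambda>v. Rh v)"
  using linear_into_rep(1)[OF coaction_linear] by simp

lemma coaction_lact_rep:
  "ceq (fspan (tensor_rels Bm V)) (Rh (lact V r v)) (fext (\<lambda>(b, v0). monom (\<xi> r * b, v0)) (Rh v))"
  unfolding coaction_lact tensor_lact_def psum_gen2 using rep_coset[of "tensor2 Bm V"] by simp

lemma coaction_coassoc_rep:
  "ceq (rspan (tensor3 Bm Bm V))
     (fext (\<lambda>(b, v0). fext (\<lambda>(b1, b2). monom (b1, b2, v0)) (B.D b)) (Rh v))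
     (fext (\<lambda>(b, v0). fext (\<lambda>(b', v'). monom (b, b', v')) (Rh v0)) (Rh v))"
  using coaction_coassoc[of v] by (simp add: psum_gen2 psum_rep2 coset_eq_iff)

text \<open>The right action \<open>v \<cdot> r = \<epsilon>(v\<^sub>[\<^sub>-\<^sub>1\<^sub>] \<xi>(r)) \<cdot> v\<^sub>[\<^sub>0\<^sub>]\<close> of a comodule.\<close>

definition induced_ract where
  "induced_ract v r = linext (scale V) (\<lambda>(b, v0). lact V (\<epsilon> (b * \<xi> r)) v0) (Rh v)"

lemma monom_target: "ceq (fspan (tensor_rels Bm V)) (monom (\<zeta> r * b, v)) (monom (b, lact V r v))"
  using balancedD(3)[OF balanced_monom[of Bm V], of b r v] by simp

text \<open>Apply \<open>?g\<close> to coassociativity. With two coactions, left linearity of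
  \<open>\<rho>\<close> recognises the coaction of \<open>v \<cdot> r\<close>; with
  \<open>\<Delta>\<close>, the sum collapses to \<open>b * \<xi> r\<close>.\<close>

lemma coaction_induced_ract:
  "ceq (fspan (tensor_rels Bm V)) (Rh (induced_ract v r)) (fext (\<lambda>(b, v0). monom (b * \<xi> r, v0)) (Rh v))"
proof -
  let ?S = "fspan (tensor_rels Bm V)"
  let ?g = "\<lambda>r b b' v. monom (\<xi> (\<epsilon> (b * \<xi> r)) * b', v)"
  have lin: "linear_mod sB fscale ?S (\<lambda>b. monom (b, v))" for v
    using balancedD(1)[OF balanced_monom[of Bm V]] by simp
  have g1: "balanced fscale ?S Bm Bm (\<lambda>b b'. ?g r b b' v)" for r v
  proof (rule balancedI)
    have "k_linear sB sB (\<lambda>b. \<xi> (\<epsilon> (b * \<xi> r)) * b')" for b'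
      by (intro k_linear_comp[OF algB.k_linear_mult(2)] k_linear_comp[OF source_linear]
          k_linear_comp[OF k_linear_counit] algB.k_linear_mult(2))
    then show "linear_mod (scale Bm) fscale ?S (\<lambda>b. ?g r b b' v)" for b'
      unfolding base_bimod_simps by (rule linear_mod_comp[OF lin])
    show "linear_mod (scale Bm) fscale ?S (\<lambda>b'. ?g r b b' v)" for b
      using linear_mod_comp[OF lin algB.k_linear_mult(1)] by simp
    show "ceq ?S (?g r (ract Bm b s) b' v) (?g r b (lact Bm s b') v)" for b s b'
      by (simp add: mult.assoc)
  qed
  have g2: "balanced fscale ?S Bm V (?g r b)" for r b
    by (rule left_mult_source_balanced)
  \<comment> \<open>By \<open>comult_mult_source\<close>, \<open>?g r\<close> summed over
    \<open>\<Delta> b\<close> is \<open>?g 1\<close> summed over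
    \<open>\<Delta> (b * \<xi> r)\<close>, which the left counit axiom evaluates.\<close>
  have inner: "ceq ?S (fext (\<lambda>(b1, b2). ?g r b1 b2 v) (B.D b)) (monom (b * \<xi> r, v))" for b v
  proof -
    have "ceq ?S (fext (\<lambda>(b1, b2). ?g 1 b1 b2 v) (B.D (b * \<xi> r)))
        (fext (\<lambda>(b1, b2). ?g 1 b1 b2 v) (fext (\<lambda>(b1, b2). monom (b1 * \<xi> r, b2)) (B.D b)))"
      using g1 comult_mult_source by (rule span.ceq_linext_balanced)
    also have "\<dots> = fext (\<lambda>(b1, b2). ?g r b1 b2 v) (B.D b)"
      by (simp add: free.linext_fext case_prod_unfold)
    finally have "ceq ?S (fext (\<lambda>(b1, b2). ?g r b1 b2 v) (B.D b)) (fext (\<lambda>(b1, b2). ?g 1 b1 b2 v) (B.D (b * \<xi> r)))"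
      by (rule span.ceq_sym)
    also have "ceq ?S \<dots> (monom (linext sB (\<lambda>(b1, b2). \<xi> (\<epsilon> (b1 * \<xi> 1)) * b2) (B.D (b * \<xi> r)), v))"
      by (rule span.ceq_linext_map2[OF lin])
    finally show ?thesis using B.counit_left_rep[of "b * \<xi> r"] by simp
  qed
  have "ceq ?S (Rh (induced_ract v r))
      (fext (\<lambda>(b, v0). Rh (lact V (\<epsilon> (b * \<xi> r)) v0)) (Rh v))"
    unfolding induced_ract_def by (rule span.ceq_sym, rule span.ceq_linext_map2[OF coaction_linear_mod])
  also have "ceq ?S \<dots> (fext (\<lambda>(b, v0). fext (\<lambda>(b', v'). ?g r b b' v') (Rh v0)) (Rh v))"
    by (rule span.ceq_linext2) (rule coaction_lact_rep)
  also have "\<dots> = fext (\<lambda>(b, b', v'). ?g r b b' v')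
      (fext (\<lambda>(b, v0). fext (\<lambda>(b', v'). monom (b, b', v')) (Rh v0)) (Rh v))"
    by (simp add: free.linext_fext case_prod_unfold)
  also have "ceq ?S \<dots> (fext (\<lambda>(b, b', v'). ?g r b b' v')
      (fext (\<lambda>(b, v0). fext (\<lambda>(b1, b2). monom (b1, b2, v0)) (B.D b)) (Rh v)))"
    using g1 g2 span.ceq_sym[OF coaction_coassoc_rep] by (rule span.ceq_linext_trilinear)
  also have "\<dots> = fext (\<lambda>(b, v0). fext (\<lambda>(b1, b2). ?g r b1 b2 v0) (B.D b)) (Rh v)"
    by (simp add: free.linext_fext case_prod_unfold)
  also have "ceq ?S \<dots> (fext (\<lambda>(b, v0). monom (b * \<xi> r, v0)) (Rh v))"
    by (rule span.ceq_linext2) (rule inner)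
  finally show ?thesis .
qed

text \<open>Apply \<open>?h\<close> to coassociativity. With two coactions the inner one assembles
  to \<open>v0 \<cdot> r\<close>; the side with \<open>\<Delta>\<close> inherits the Takeuchi
  property from the bialgebroid.\<close>

lemma coaction_takeuchi:
  "ceq (fspan (tensor_rels Bm V)) (fext (\<lambda>(b, v0). monom (b * \<zeta> r, v0)) (Rh v))
     (fext (\<lambda>(b, v0). monom (b, induced_ract v0 r)) (Rh v))"
proof -
  let ?S = "fspan (tensor_rels Bm V)"
  let ?h = "\<lambda>b b' v. monom (b, lact V (\<epsilon> (b' * \<xi> r)) v)"
  have lin1: "linear_mod sB fscale ?S (\<lambda>b. monom (b, v))" for v
    using balancedD(1)[OF balanced_monom[of Bm V]] by simp
  have lin2: "linear_mod (scale V) fscale ?S (\<lambda>v. monom (b, v))" for b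
    using balancedD(2)[OF balanced_monom[of Bm V]] by simp
  have lin': "linear_mod sB fscale ?S (\<lambda>b'. ?h b b' v)" for b v
    by (intro linear_mod_comp[OF lin2] k_linear_comp[OF V.lact_linear_ring]
        k_linear_comp[OF k_linear_counit] algB.k_linear_mult(2))
  have h1: "balanced fscale ?S Bm Bm (\<lambda>b b'. ?h b b' v)" for v
    using lin1 lin' monom_target by (intro balancedI) (simp_all add: mult.assoc V.lact_mult)
  have h2: "balanced fscale ?S Bm V (?h b)" for b
    using lin' linear_mod_comp[OF lin2 V.lact_linear] by (intro balancedI) (simp_all add: mult.assoc V.lact_mult)
  have k: "balanced fscale ?S Bm Bm (\<lambda>b1 b2. monom (\<zeta> (\<epsilon> b2) * b1, v))" for v
  proof (rule balancedI)
    show "linear_mod (scale Bm) fscale ?S (\<lambda>b1. monom (\<zeta> (\<epsilon> b2) * b1, v))" for b2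
      using linear_mod_comp[OF lin1 algB.k_linear_mult(1)] by simp
    have "k_linear sB sB (\<lambda>b2. \<zeta> (\<epsilon> b2) * b1)" for b1
      by (intro k_linear_comp[OF algB.k_linear_mult(2)] k_linear_comp[OF target_linear] k_linear_counit)
    then show "linear_mod (scale Bm) fscale ?S (\<lambda>b2. monom (\<zeta> (\<epsilon> b2) * b1, v))" for b1
      unfolding base_bimod_simps by (rule linear_mod_comp[OF lin1])
  qed (simp add: mult.assoc)
  \<comment> \<open>The scalar is moved from \<open>v\<close> to the first leg as a left factor
    \<open>\<zeta> (\<epsilon> (b2 * \<xi> r))\<close>; \<open>takeuchi_rep\<close> then trades
    \<open>\<xi> r\<close> on the second leg for \<open>\<zeta> r\<close> on the first, and the
    right counit axiom leaves \<open>b * \<zeta> r\<close>.\<close>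
  have inner: "ceq ?S (fext (\<lambda>(b1, b2). ?h b1 b2 v) (B.D b)) (monom (b * \<zeta> r, v))" for b v
  proof -
    have "ceq ?S (fext (\<lambda>(b1, b2). ?h b1 b2 v) (B.D b))
        (fext (\<lambda>(b1, b2). monom (\<zeta> (\<epsilon> (b2 * \<xi> r)) * b1, v)) (B.D b))"
      by (rule span.ceq_linext2) (rule span.ceq_sym[OF monom_target])
    also have "\<dots> = fext (\<lambda>(b1, b2). monom (\<zeta> (\<epsilon> b2) * b1, v)) (fext (\<lambda>(b1, b2). monom (b1, b2 * \<xi> r)) (B.D b))"
      by (simp add: free.linext_fext case_prod_unfold)
    also have "ceq ?S \<dots> (fext (\<lambda>(b1, b2). monom (\<zeta> (\<epsilon> b2) * b1, v)) (fext (\<lambda>(b1, b2). monom (b1 * \<zeta> r, b2)) (B.D b)))"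
      using k span.ceq_sym[OF takeuchi_rep] by (rule span.ceq_linext_balanced)
    also have "\<dots> = fext (\<lambda>(b1, b2). monom ((\<zeta> (\<epsilon> b2) * b1) * \<zeta> r, v)) (B.D b)"
      by (simp add: free.linext_fext case_prod_unfold mult.assoc)
    also have "ceq ?S \<dots> (monom (linext sB (\<lambda>(b1, b2). \<zeta> (\<epsilon> b2) * b1) (B.D b) * \<zeta> r, v))"
      by (rule span.ceq_linext_map2[OF linear_mod_comp[OF lin1 algB.k_linear_mult(2)]])
    finally show ?thesis using B.counit_right_rep[of b] by simp
  qed
  have "ceq ?S (fext (\<lambda>(b, v0). monom (b * \<zeta> r, v0)) (Rh v))
      (fext (\<lambda>(b, v0). fext (\<lambda>(b1, b2). ?h b1 b2 v0) (B.D b)) (Rh v))"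
    by (rule span.ceq_linext2) (rule span.ceq_sym[OF inner])
  also have "\<dots> = fext (\<lambda>(b, b', v'). ?h b b' v')
      (fext (\<lambda>(b, v0). fext (\<lambda>(b1, b2). monom (b1, b2, v0)) (B.D b)) (Rh v))"
    by (simp add: free.linext_fext case_prod_unfold)
  also have "ceq ?S \<dots> (fext (\<lambda>(b, b', v'). ?h b b' v')
      (fext (\<lambda>(b, v0). fext (\<lambda>(b', v'). monom (b, b', v')) (Rh v0)) (Rh v)))"
    using h1 h2 coaction_coassoc_rep by (rule span.ceq_linext_trilinear)
  also have "\<dots> = fext (\<lambda>(b, v0). fext (\<lambda>(b', v'). ?h b b' v') (Rh v0)) (Rh v)"
    by (simp add: free.linext_fext case_prod_unfold)
  also have "ceq ?S \<dots> (fext (\<lambda>(b, v0). monom (b, induced_ract v0 r)) (Rh v))"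
    unfolding induced_ract_def by (rule span.ceq_linext2) (rule span.ceq_linext_map2[OF lin2])
  finally show ?thesis .
qed

end

context left_comodule_coring
begin

text \<open>From here on the two properties above speak about the right action of the
  coring.\<close>

lemma induced_ract_eq: "induced_ract c r = ract C c r"
  using comodule_ract[of c r] by (simp add: induced_ract_def msum_def)

lemma comodule_counit_rep: "linext sB (\<lambda>(b, c'). \<zeta> (\<epsilon>C c') * b) (Rh c) = \<xi> (\<epsilon>C c)"
  using comodule_counit by (simp add: msum_def)

lemma comodule_comult_rep:
  "ceq (rspan (tensor3 Bm C C))
     (fext (\<lambda>(b, c'). fext (\<lambda>(c1, c2). monom (b, c1, c2)) (C.D c')) (Rh c))
     (fext (\<lambda>(c1, c2). fext (\<lambda>(b1, c1'). fext (\<lambda>(b2, c2'). monom (b1 * b2, c1', c2')) (Rh c2)) (Rh c1)) (C.D c))"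
  using comodule_comult[of c] by (simp add: psum_gen2 psum_rep2 coset_eq_iff)

context
  fixes A :: "('w \<Rightarrow>\<^sub>0 'k) set" and f :: "'b \<Rightarrow> 'c \<Rightarrow> ('w \<Rightarrow>\<^sub>0 'k)"
  assumes f: "balanced fscale (fspan A) Bm C f"
begin

lemma linear_mod_coaction: "linear_mod (scale C) fscale (fspan A) (\<lambda>c. fext (\<lambda>(b, c'). f b c') (Rh c))"
  using coaction_linear_mod span.ceq_linext_balanced[OF f] by (rule span.linear_mod_linext_arg)

lemma ceq_coaction_lact:
  "ceq (fspan A) (fext (\<lambda>(b, c'). f b c') (Rh (lact C r c))) (fext (\<lambda>(b, c'). f (\<xi> r * b) c') (Rh c))"
  using span.ceq_linext_balanced[OF f coaction_lact_rep]
  by (simp add: free.linext_fext case_prod_unfold)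

lemma ceq_coaction_ract:
  "ceq (fspan A) (fext (\<lambda>(b, c'). f b c') (Rh (ract C c r))) (fext (\<lambda>(b, c'). f (b * \<xi> r) c') (Rh c))"
  using span.ceq_linext_balanced[OF f coaction_induced_ract]
  by (simp add: free.linext_fext case_prod_unfold induced_ract_eq)

lemma ceq_coaction_takeuchi:
  "ceq (fspan A) (fext (\<lambda>(b, c'). f (b * \<zeta> r) c') (Rh c)) (fext (\<lambda>(b, c'). f b (ract C c' r)) (Rh c))"
  using span.ceq_linext_balanced[OF f coaction_takeuchi]
  by (simp add: free.linext_fext case_prod_unfold induced_ract_eq)

end

end


section \<open>The transposition map\<close>

lemma msum_coset:
  assumes "k_module s" "balanced s {0} M N f"
  shows "msum s (coset (tensor2 M N) p) (\<lambda>(m, n). f m n) = linext s (\<lambda>(m, n). f m n) p"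
  using k_submodule.ceq_linext_balanced[OF k_module.k_submodule_zero[OF assms(1)] assms(2)]
    rep_coset[of "tensor2 M N" p] by (simp add: msum_def)

lemma bimod_along_simps [simp]:
  "scale (bimod_along \<xi> \<zeta> V) = scale V" "lact (bimod_along \<xi> \<zeta> V) r x = lact V (\<xi> r) x"
  "ract (bimod_along \<xi> \<zeta> V) x r = lact V (\<zeta> r) x"
  by (simp_all add: bimod_along_def)

lemma induces_tensor_lact:
  assumes M: "bimodule sR M"
  shows "induces (tensor2 M N) (tensor2 M N) (tensor_lact M N r) (\<lambda>(m, n). monom (lact M r m, n))"
proof -
  interpret bimodule sR M by fact
  note m = balanced_monom[of M N]
  have "balanced fscale (fspan (tensor_rels M N)) M N (\<lambda>m n. monom (lact M r m, n))"
    using linear_mod_comp[OF balancedD(1)[OF m] lact_linear] balancedD(2,3)[OF m]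
    by (intro balancedI) (simp_all add: lact_ract)
  then show ?thesis
    using induces_psum[of "tensor2 M N" "tensor2 M N", OF balanced_descends]
    by (simp add: tensor_lact_def[abs_def] gen_def case_prod_unfold)
qed

lemma induces_tensor_ract:
  assumes N: "bimodule sR N"
  shows "induces (tensor2 M N) (tensor2 M N) (\<lambda>t. tensor_ract M N t r) (\<lambda>(m, n). monom (m, ract N n r))"
proof -
  interpret bimodule sR N by fact
  note m = balanced_monom[of M N]
  have "balanced fscale (fspan (tensor_rels M N)) M N (\<lambda>m n. monom (m, ract N n r))"
    using linear_mod_comp[OF balancedD(2)[OF m] ract_linear] balancedD(1,3)[OF m]
    by (intro balancedI) (simp_all flip: lact_ract)
  then show ?thesis
    using induces_psum[of "tensor2 M N" "tensor2 M N", OF balanced_descends]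
    by (simp add: tensor_ract_def[abs_def] gen_def case_prod_unfold)
qed

locale comodule_coring_and_module =
  left_comodule_coring sR sB \<xi> \<zeta> \<Delta> \<epsilon> C \<Delta>C \<epsilon>C \<rho> + M: left_module sB V
  for sR :: "'k::{comm_ring, comm_monoid_mult} \<Rightarrow> 'r::{ring, monoid_mult} \<Rightarrow> 'r"
    and sB :: "'k \<Rightarrow> 'b::{ring, monoid_mult} \<Rightarrow> 'b"
    and \<xi> \<zeta> \<Delta> \<epsilon>
    and C :: "('k, 'r, 'c::ab_group_add) bimod"
    and \<Delta>C \<epsilon>C \<rho>
    and V :: "('k, 'b, 'x::ab_group_add) lmod"
begin

abbreviation X where "X \<equiv> bimod_along \<xi> \<zeta> V"

lemma bimodule_along: "bimodule sR X"
proof -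
  have "k_module (scale V)" by (rule M.k_module_axioms)
  then show ?thesis
    using algR.k_algebra_axioms source_linear target_linear M.lact_linear
    by (simp add: bimodule_def bimodule_axioms_def left_module_def left_module_axioms_def
        k_linear_def source_target_commute flip: M.lact_mult)
qed

sublocale cyc: coring_and_bimodule sR C \<Delta>C \<epsilon>C X
  by (intro coring_and_bimodule.intro C.coring_axioms bimodule_along)

lemma k_linear_mult_lact: "k_linear sB (scale V) (\<lambda>b. lact V b x)"
  by (rule M.lact_linear_ring)

definition transp where "transp c x = fext (\<lambda>(b, c'). monom (lact V b x, c')) (Rh c)"

definition transp_map where
  "transp_map t = psum (tensor2 X C) t (\<lambda>(c, x). coset (tensor2 X C) (transp c x))"

text \<open>On \<open>B\<close> and on \<open>X\<close> alike, the right action of \<open>r\<close>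
  is left multiplication by \<open>\<zeta> r\<close>, so acting on a fixed \<open>x\<close>
  preserves the balancing.\<close>

lemma balanced_act:
  assumes "balanced fscale (fspan A) X C f"
  shows "balanced fscale (fspan A) Bm C (\<lambda>b c'. f (lact V b x) c')"
proof (rule balancedI)
  show "linear_mod (scale Bm) fscale (fspan A) (\<lambda>b. f (lact V b x) c')" for c'
    using linear_mod_comp[OF balancedD(1)[OF assms], unfolded bimod_along_simps, OF k_linear_mult_lact] by simp
  show "linear_mod (scale C) fscale (fspan A) (f (lact V b x))" for b
    by (rule balancedD(2)[OF assms])
  show "ceq (fspan A) (f (lact V (ract Bm b r) x) c') (f (lact V b x) (lact C r c'))" for b r c'
    using balancedD(3)[OF assms, of "lact V b x" r c'] by (simp add: M.lact_mult)
qed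

text \<open>With a general \<open>f\<close> this covers \<open>w\<close> itself and also
  \<open>w\<close> applied inside a longer tensor product.\<close>

lemma balanced_transp:
  assumes "balanced fscale (fspan A) X C f"
  shows "balanced fscale (fspan A) C X (\<lambda>c x. fext (\<lambda>(b, c'). f (lact V b x) c') (Rh c))"
proof (rule balancedI)
  show "linear_mod (scale C) fscale (fspan A) (\<lambda>c. fext (\<lambda>(b, c'). f (lact V b x) c') (Rh c))" for x
    by (rule linear_mod_coaction[OF balanced_act[OF assms]])
  show "linear_mod (scale X) fscale (fspan A) (\<lambda>x. fext (\<lambda>(b, c'). f (lact V b x) c') (Rh c))" for c
    using linear_mod_comp[OF balancedD(1)[OF assms], unfolded bimod_along_simps, OF M.lact_linear]
    by (auto intro!: span.linear_mod_linext2)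
  show "ceq (fspan A) (fext (\<lambda>(b, c'). f (lact V b x) c') (Rh (ract C c r)))
      (fext (\<lambda>(b, c'). f (lact V b (lact X r x)) c') (Rh c))" for c r x
    using ceq_coaction_ract[OF balanced_act[OF assms, of x], of c r] by (simp add: M.lact_mult)
qed

lemma induces_transp_map: "induces (tensor2 C X) (tensor2 X C) transp_map (\<lambda>(c, x). transp c x)"
proof -
  have "descends (tensor2 C X) (rspan (tensor2 X C)) (\<lambda>(c, x). transp c x)"
    unfolding transp_def using balanced_descends[OF balanced_transp[OF balanced_monom]] by simp
  from induces_psum[OF this] show ?thesis
    by (simp add: transp_map_def[abs_def] case_prod_unfold)
qed

lemma transp_map_gen: "transp_map (gen (tensor2 C X) (c, x)) = coset (tensor2 X C) (transp c x)"
  using induces_transp_map by (simp add: gen_def induces_def)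

lemma transp_counit:
  "linext (scale V) (\<lambda>(x, c). lact V (\<zeta> (\<epsilon>C c)) x) (transp c x) = lact V (\<xi> (\<epsilon>C c)) x"
proof -
  have "linext (scale V) (\<lambda>(x, c). lact V (\<zeta> (\<epsilon>C c)) x) (transp c x) =
      linext (scale V) (\<lambda>(b, c'). lact V (\<zeta> (\<epsilon>C c') * b) x) (Rh c)"
    by (simp add: transp_def M.linext_fext case_prod_unfold M.lact_mult)
  also have "\<dots> = lact V (linext sB (\<lambda>(b, c'). \<zeta> (\<epsilon>C c') * b) (Rh c)) x"
    by (simp add: M.linear_linext[OF k_linear_mult_lact] case_prod_unfold)
  finally show ?thesis by (simp add: comodule_counit_rep)
qed

text \<open>The comultiplication axiom with each coaction factor made to act on \<open>x\<close>.
  The map \<open>f\<close> is left open because the same identity is needed in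
  \<open>X \<otimes> C \<otimes> C\<close> and in the cyclic tensor product.\<close>

lemma transp_comult:
  assumes "\<And>c. balanced fscale (fspan A) X C (\<lambda>x c'. f x c' c)" "\<And>x. balanced fscale (fspan A) C C (f x)"
  shows "ceq (fspan A)
     (fext (\<lambda>(b, c'). fext (\<lambda>(c1, c2). f (lact V b x) c1 c2) (C.D c')) (Rh c))
     (fext (\<lambda>(c1, c2). fext (\<lambda>(b2, c2'). fext (\<lambda>(b1, c1'). f (lact V b1 (lact V b2 x)) c1' c2') (Rh c1)) (Rh c2)) (C.D c))"
proof -
  let ?g = "\<lambda>b c1 c2. f (lact V b x) c1 c2"
  have "ceq (fspan A)
      (fext (\<lambda>(b, c1, c2). ?g b c1 c2) (fext (\<lambda>(b, c'). fext (\<lambda>(c1, c2). monom (b, c1, c2)) (C.D c')) (Rh c)))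
      (fext (\<lambda>(b, c1, c2). ?g b c1 c2) (fext (\<lambda>(c1, c2). fext (\<lambda>(b1, c1').
        fext (\<lambda>(b2, c2'). monom (b1 * b2, c1', c2')) (Rh c2)) (Rh c1)) (C.D c)))"
    using balanced_act[OF assms(1)] assms(2) comodule_comult_rep by (rule span.ceq_linext_trilinear)
  \<comment> \<open>The axiom nests the coaction of \<open>c1\<close> outside, whereas composing
    transpositions moves \<open>c2\<close> first.\<close>
  moreover have "fext (\<lambda>(b1, c1'). fext (\<lambda>(b2, c2'). ?g (b1 * b2) c1' c2') (Rh c2)) (Rh c1) =
      fext (\<lambda>(b2, c2'). fext (\<lambda>(b1, c1'). f (lact V b1 (lact V b2 x)) c1' c2') (Rh c1)) (Rh c2)" for c1 c2
    unfolding case_prod_unfold M.lact_mult by (rule free.linext_swap)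
  ultimately show ?thesis by (simp add: free.linext_fext case_prod_unfold)
qed

theorem transposition_map_transp: "transposition_map C \<Delta>C \<epsilon>C X transp_map"
  unfolding transposition_map_def
proof (intro conjI allI ballI)
  show "phom (tensor2 C X) (tensor2 X C) transp_map"
    by (rule phom_induces[OF induces_transp_map]) simp
next
  fix r t assume t: "t \<in> pcarrier (tensor2 C X)"
  show "transp_map (tensor_lact C X r t) = tensor_lact X C r (transp_map t)"
  proof (rule induces_eq[OF induces_comp[OF induces_tensor_lact[OF C.bimodule_axioms] induces_transp_map]
        induces_comp[OF induces_transp_map induces_tensor_lact[OF bimodule_along]] _ t])
    fix w
    show "ceq (rspan (tensor2 X C))
        (fext (\<lambda>(c, x). transp c x) (case w of (c, x) \<Rightarrow> monom (lact C r c, x)))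
        (fext (\<lambda>(x, c). monom (lact X r x, c)) (case w of (c, x) \<Rightarrow> transp c x))"
      using ceq_coaction_lact[OF balanced_act[OF balanced_monom]]
      by (cases w) (simp add: transp_def free.linext_fext case_prod_unfold M.lact_mult)
  qed
next
  fix r t assume t: "t \<in> pcarrier (tensor2 C X)"
  show "transp_map (tensor_ract C X t r) = tensor_ract X C (transp_map t) r"
  proof (rule induces_eq[OF induces_comp[OF induces_tensor_ract[OF bimodule_along] induces_transp_map]
        induces_comp[OF induces_transp_map induces_tensor_ract[OF C.bimodule_axioms]] _ t])
    fix w
    show "ceq (rspan (tensor2 X C))
        (fext (\<lambda>(c, x). transp c x) (case w of (c, x) \<Rightarrow> monom (c, ract X x r)))
        (fext (\<lambda>(x, c). monom (x, ract C c r)) (case w of (c, x) \<Rightarrow> transp c x))"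
      using ceq_coaction_takeuchi[OF balanced_act[OF balanced_monom]]
      by (cases w) (simp add: transp_def free.linext_fext case_prod_unfold M.lact_mult)
  qed
next
  fix t assume "t \<in> pcarrier (tensor2 C X)"
  then obtain p where t: "t = coset (tensor2 C X) p" by (auto simp: pcarrier_def)
  have l: "linear_mod (scale V) (scale V) {0} (lact V b)" for b
    using M.lact_linear[of b] by (simp add: linear_mod_def k_linear_def)
  have l': "linear_mod (scale C) (scale V) {0} (\<lambda>c. lact V (h (\<epsilon>C c)) x)" if "k_linear sR sB h" for h x
    using that by (simp add: linear_mod_def k_linear_def)
  have "balanced (scale V) {0} X C (\<lambda>x c. lact V (\<zeta> (\<epsilon>C c)) x)"
    using l l'[OF target_linear] by (intro balancedI) (simp_all add: M.lact_mult)
  note XC = msum_coset[OF M.k_module_axioms this]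
  have "balanced (scale V) {0} C X (\<lambda>c x. lact V (\<xi> (\<epsilon>C c)) x)"
    using l l'[OF source_linear] by (intro balancedI) (simp_all add: M.lact_mult)
  note CX = msum_coset[OF M.k_module_axioms this]
  have "transp_map t = coset (tensor2 X C) (fext (\<lambda>(c, x). transp c x) p)"
    using induces_transp_map t by (simp add: induces_def)
  then have "msum (scale V) (transp_map t) (\<lambda>(x, c). lact V (\<zeta> (\<epsilon>C c)) x) =
      linext (scale V) (\<lambda>(c, x). linext (scale V) (\<lambda>(x, c). lact V (\<zeta> (\<epsilon>C c)) x) (transp c x)) p"
    by (simp only: XC M.linext_fext prod.case_distrib)
  then show "msum (scale X) (transp_map t) (\<lambda>(x, c). ract X x (\<epsilon>C c)) =
      msum (scale X) t (\<lambda>(c, x). lact X (\<epsilon>C c) x)"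
    by (simp only: t CX transp_counit bimod_along_simps)
next
  fix t assume t: "t \<in> pcarrier (tensor2 C X)"
  let ?T = "tensor3 X C C"
  let ?XD = "\<lambda>u. psum ?T u (\<lambda>(x, c). psum ?T (\<Delta>C c) (\<lambda>(c1, c2). gen ?T (x, c1, c2)))"
  let ?DX = "\<lambda>u. psum (tensor3 C C X) u (\<lambda>(c, x).
    psum (tensor3 C C X) (\<Delta>C c) (\<lambda>(c1, c2). gen (tensor3 C C X) (c1, c2, x)))"
  let ?Cw = "\<lambda>u. psum (tensor3 C X C) u (\<lambda>(c, c', x).
    psum (tensor3 C X C) (transp_map (gen (tensor2 C X) (c', x))) (\<lambda>(x', c''). gen (tensor3 C X C) (c, x', c'')))"
  let ?wC = "\<lambda>u. psum ?T u (\<lambda>(c, x, c').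
    psum ?T (transp_map (gen (tensor2 C X) (c, x))) (\<lambda>(x', c''). gen ?T (x', c'', c')))"
  \<comment> \<open>The inner sums of \<open>C \<otimes> w\<close> and \<open>w \<otimes> C\<close>
    run over a representative of a value of \<open>w\<close>; a balanced summand lets the explicit
    sum over \<open>\<rho> c\<close> take its place.\<close>
  have transp_psum: "psum Q (transp_map (gen (tensor2 C X) (c, x))) (\<lambda>(x', c''). gen Q (g x' c''))
      = coset Q (fext (\<lambda>(b, c'). monom (g (lact V b x) c')) (Rh c))"
    if "balanced fscale (rspan Q) X C (\<lambda>x' c''. monom (g x' c''))" for Q :: "('w, 'k) presentation" and g c x
  proof -
    have "ceq (rspan Q) (fext (\<lambda>(x', c''). monom (g x' c'')) (rep (coset (tensor2 X C) (transp c x))))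
        (fext (\<lambda>(x', c''). monom (g x' c'')) (transp c x))"
      using that rep_coset[of "tensor2 X C"] by (intro span.ceq_linext_balanced) simp_all
    then show ?thesis
      unfolding psum_gen2 transp_map_gen coset_eq_iff
      by (simp add: transp_def free.linext_fext case_prod_unfold)
  qed
  have XD: "induces (tensor2 X C) ?T ?XD (\<lambda>(x, c). fext (\<lambda>(c1, c2). monom (x, c1, c2)) (C.D c))"
  proof -
    have "balanced fscale (rspan ?T) X C (\<lambda>x c. fext (\<lambda>(c1, c2). monom (x, c1, c2)) (C.D c))"
    proof (rule balancedI)
      show "linear_mod (scale X) fscale (rspan ?T) (\<lambda>x. fext (\<lambda>(c1, c2). monom (x, c1, c2)) (C.D c))" for c
        by (rule span.linear_mod_linext2) (rule balancedD(1)[OF balanced_monom3(1)])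
      show "linear_mod (scale C) fscale (rspan ?T) (\<lambda>c. fext (\<lambda>(c1, c2). monom (x, c1, c2)) (C.D c))" for x
        by (rule C.linear_mod_comult[OF balanced_monom3(2)])
      fix x r c
      have "ceq (rspan ?T) (fext (\<lambda>(c1, c2). monom (ract X x r, c1, c2)) (C.D c))
          (fext (\<lambda>(c1, c2). monom (x, lact C r c1, c2)) (C.D c))"
        by (rule span.ceq_linext2) (rule balancedD(3)[OF balanced_monom3(1)])
      also have "ceq (rspan ?T) \<dots> (fext (\<lambda>(c1, c2). monom (x, c1, c2)) (C.D (lact C r c)))"
        by (rule span.ceq_sym[OF C.ceq_comult_lact[OF balanced_monom3(2)]])
      finally show "ceq (rspan ?T) (fext (\<lambda>(c1, c2). monom (ract X x r, c1, c2)) (C.D c))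
          (fext (\<lambda>(c1, c2). monom (x, c1, c2)) (C.D (lact C r c)))" .
    qed
    from induces_psum[OF balanced_descends[OF this]] show ?thesis
      by (simp only: psum_gen2 prod.case_distrib[of "coset _"])
  qed
  have DX: "induces (tensor2 C X) (tensor3 C C X) ?DX (\<lambda>(c, x). fext (\<lambda>(c1, c2). monom (c1, c2, x)) (C.D c))"
  proof -
    let ?S = "rspan (tensor3 C C X)"
    have "balanced fscale ?S C X (\<lambda>c x. fext (\<lambda>(c1, c2). monom (c1, c2, x)) (C.D c))"
    proof (rule balancedI)
      show "linear_mod (scale C) fscale ?S (\<lambda>c. fext (\<lambda>(c1, c2). monom (c1, c2, x)) (C.D c))" for x
        by (rule C.linear_mod_comult[OF balanced_monom3(1)])
      show "linear_mod (scale X) fscale ?S (\<lambda>x. fext (\<lambda>(c1, c2). monom (c1, c2, x)) (C.D c))" for c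
        by (rule span.linear_mod_linext2) (rule balancedD(2)[OF balanced_monom3(2)])
      fix c r x
      have "ceq ?S (fext (\<lambda>(c1, c2). monom (c1, c2, x)) (C.D (ract C c r)))
          (fext (\<lambda>(c1, c2). monom (c1, ract C c2 r, x)) (C.D c))"
        by (rule C.ceq_comult_ract[OF balanced_monom3(1)])
      also have "ceq ?S \<dots> (fext (\<lambda>(c1, c2). monom (c1, c2, lact X r x)) (C.D c))"
        by (rule span.ceq_linext2) (rule balancedD(3)[OF balanced_monom3(2)])
      finally show "ceq ?S (fext (\<lambda>(c1, c2). monom (c1, c2, x)) (C.D (ract C c r)))
          (fext (\<lambda>(c1, c2). monom (c1, c2, lact X r x)) (C.D c))" .
    qed
    from induces_psum[OF balanced_descends[OF this]] show ?thesis
      by (simp only: psum_gen2 prod.case_distrib[of "coset _"])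
  qed
  have Cw: "induces (tensor3 C C X) (tensor3 C X C) ?Cw
      (\<lambda>(c, c', x). fext (\<lambda>(b, c''). monom (c, lact V b x, c'')) (Rh c'))"
  proof -
    let ?S = "rspan (tensor3 C X C)"
    \<comment> \<open>At the outer tensor sign, \<open>C \<otimes> w\<close> is well defined since
      the coaction is left linear, that is, since \<open>w\<close> is.\<close>
    have "balanced fscale ?S C C (\<lambda>c c'. fext (\<lambda>(b, c''). monom (c, lact V b x, c'')) (Rh c'))" for x
    proof (rule balancedI)
      note b = balanced_act[OF balanced_monom3(2)]
      show "linear_mod (scale C) fscale ?S (\<lambda>c. fext (\<lambda>(b, c''). monom (c, lact V b x, c'')) (Rh c'))" for c'
        by (rule span.linear_mod_linext2) (rule balancedD(1)[OF balanced_monom3(1)])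
      show "linear_mod (scale C) fscale ?S (\<lambda>c'. fext (\<lambda>(b, c''). monom (c, lact V b x, c'')) (Rh c'))" for c
        by (rule linear_mod_coaction[OF b])
      fix c r c'
      have "ceq ?S (fext (\<lambda>(b, c''). monom (ract C c r, lact V b x, c'')) (Rh c'))
          (fext (\<lambda>(b, c''). monom (c, lact X r (lact V b x), c'')) (Rh c'))"
        by (rule span.ceq_linext2) (rule balancedD(3)[OF balanced_monom3(1)])
      also have "\<dots> = fext (\<lambda>(b, c''). monom (c, lact V (\<xi> r * b) x, c'')) (Rh c')"
        by (simp add: M.lact_mult)
      also have "ceq ?S \<dots> (fext (\<lambda>(b, c''). monom (c, lact V b x, c'')) (Rh (lact C r c')))"
        by (rule span.ceq_sym[OF ceq_coaction_lact[OF b]])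
      finally show "ceq ?S (fext (\<lambda>(b, c''). monom (ract C c r, lact V b x, c'')) (Rh c'))
          (fext (\<lambda>(b, c''). monom (c, lact V b x, c'')) (Rh (lact C r c')))" .
    qed
    moreover have "balanced fscale ?S C X (\<lambda>c' x. fext (\<lambda>(b, c''). monom (c, lact V b x, c'')) (Rh c'))" for c
      by (rule balanced_transp[OF balanced_monom3(2)])
    ultimately show ?thesis
      using induces_psum[OF trilinear_descends[of _ C C "(\<lambda>c c' x. fext (\<lambda>(b, c''). monom (c, lact V b x, c'')) (Rh c'))" X]]
      by (simp only: transp_psum[OF balanced_monom3(2)] prod.case_distrib[of "coset _"])
  qed
  have wC: "induces (tensor3 C X C) ?T ?wC
      (\<lambda>(c, x, c'). fext (\<lambda>(b, c''). monom (lact V b x, c'', c')) (Rh c))"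
  proof -
    let ?S = "rspan ?T"
    \<comment> \<open>At the outer tensor sign, \<open>w \<otimes> C\<close> needs right linearity
      of \<open>w\<close>, hence the Takeuchi property of the coaction.\<close>
    have "balanced fscale ?S X C (\<lambda>x c'. fext (\<lambda>(b, c''). monom (lact V b x, c'', c')) (Rh c))" for c
    proof (rule balancedI)
      show "linear_mod (scale X) fscale ?S (\<lambda>x. fext (\<lambda>(b, c''). monom (lact V b x, c'', c')) (Rh c))" for c'
        by (rule balancedD(2)[OF balanced_transp[OF balanced_monom3(1)]])
      show "linear_mod (scale C) fscale ?S (\<lambda>c'. fext (\<lambda>(b, c''). monom (lact V b x, c'', c')) (Rh c))" for x
        by (rule span.linear_mod_linext2) (rule balancedD(2)[OF balanced_monom3(2)])
      fix x r c'
      have "ceq ?S (fext (\<lambda>(b, c''). monom (lact V b (ract X x r), c'', c')) (Rh c))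
          (fext (\<lambda>(b, c''). monom (lact V b x, ract C c'' r, c')) (Rh c))"
        using ceq_coaction_takeuchi[OF balanced_act[OF balanced_monom3(1)]] by (simp add: M.lact_mult)
      also have "ceq ?S \<dots> (fext (\<lambda>(b, c''). monom (lact V b x, c'', lact C r c')) (Rh c))"
        by (rule span.ceq_linext2) (rule balancedD(3)[OF balanced_monom3(2)])
      finally show "ceq ?S (fext (\<lambda>(b, c''). monom (lact V b (ract X x r), c'', c')) (Rh c))
          (fext (\<lambda>(b, c''). monom (lact V b x, c'', lact C r c')) (Rh c))" .
    qed
    moreover have "balanced fscale ?S C X (\<lambda>c x. fext (\<lambda>(b, c''). monom (lact V b x, c'', c')) (Rh c))" for c'
      by (rule balanced_transp[OF balanced_monom3(1)])
    ultimately show ?thesis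
      using induces_psum[OF trilinear_descends[of _ C X "(\<lambda>c x c'. fext (\<lambda>(b, c''). monom (lact V b x, c'', c')) (Rh c))" C]]
      by (simp only: transp_psum[OF balanced_monom3(1)] prod.case_distrib[of "coset _"])
  qed
  have "?XD (transp_map t) = ?wC (?Cw (?DX t))"
  proof (rule induces_eq[OF induces_comp[OF induces_transp_map XD]
        induces_comp[OF induces_comp[OF DX Cw] wC] _ t])
    fix w
    show "ceq (rspan ?T)
       (fext (\<lambda>(x, c). fext (\<lambda>(c1, c2). monom (x, c1, c2)) (C.D c)) (case w of (c, x) \<Rightarrow> transp c x))
       (fext (\<lambda>(c, x, c'). fext (\<lambda>(b, c''). monom (lact V b x, c'', c')) (Rh c))
         (fext (\<lambda>(c, c', x). fext (\<lambda>(b, c''). monom (c, lact V b x, c'')) (Rh c'))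
           (case w of (c, x) \<Rightarrow> fext (\<lambda>(c1, c2). monom (c1, c2, x)) (C.D c))))"
      using transp_comult[OF balanced_monom3]
      by (cases w) (simp add: transp_def free.linext_fext case_prod_unfold)
  qed
  then show "?XD (transp_map t) = (let \<Delta>X = ?DX; Cw = ?Cw; wC = ?wC in wC (Cw (\<Delta>X t)))"
    by (simp only: Let_def)
qed

end


section \<open>The para-cyclic structure\<close>

context comodule_coring_and_module
begin

definition rotate_word where
  "rotate_word = (\<lambda>(cs, x). fext (\<lambda>(b, c'). monom (c' # butlast cs, lact V b x)) (Rh (last cs)))"

lemma rotate_word_snoc [simp]:
  "rotate_word (cs @ [c], x) = fext (\<lambda>(b, c'). monom (c' # cs, lact V b x)) (Rh c)"
  by (simp add: rotate_word_def)

text \<open>The simplifier reassociates appends, after which \<open>rotate_word_snoc\<close> no longer matches.\<close>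

lemma rotate_word_snoc_Cons [simp]:
  "rotate_word (a # cs @ [c], x) = fext (\<lambda>(b, c'). monom (c' # a # cs, lact V b x)) (Rh c)"
  "rotate_word (as @ a # cs @ [c], x) = fext (\<lambda>(b, c'). monom (c' # as @ a # cs, lact V b x)) (Rh c)"
  "rotate_word (as @ a # d # cs @ [c], x) = fext (\<lambda>(b, c'). monom (c' # as @ a # d # cs, lact V b x)) (Rh c)"
  "rotate_word (as @ [a, c], x) = fext (\<lambda>(b, c'). monom (c' # as @ [a], lact V b x)) (Rh c)"
  using rotate_word_snoc[of "a # cs" c x] rotate_word_snoc[of "as @ a # cs" c x] rotate_word_snoc[of "as @ [a]" c x]
    rotate_word_snoc[of "as @ a # d # cs" c x]
  by simp_all

text \<open>Around the circle \<open>x\<close> is followed by the first letter, and the cyclic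
  relation plays the part of the tensor sign between them.\<close>

lemma balanced_rotate:
  assumes "length cs = n"
  shows "balanced fscale (rspan (cyclic_tensor C X n)) Bm C (\<lambda>b c'. monom (c' # cs, lact V b x))"
proof (rule balancedI)
  have "linear_mod (scale X) fscale (rspan (cyclic_tensor C X n)) (\<lambda>x. monom (c' # cs, x))" for c'
    using cyc.zlinear_last assms by simp
  from linear_mod_comp[OF this, unfolded bimod_along_simps, OF k_linear_mult_lact]
  show "linear_mod (scale Bm) fscale (rspan (cyclic_tensor C X n)) (\<lambda>b. monom (c' # cs, lact V b x))" for c'
    by simp
  show "linear_mod (scale C) fscale (rspan (cyclic_tensor C X n)) (\<lambda>c'. monom (c' # cs, lact V b x))" for b
    using cyc.zlinear_slot[of "[]" cs] assms by simp
  show "cyc.zeq n (monom (c' # cs, lact V (ract Bm b r) x)) (monom (lact C r c' # cs, lact V b x))" for b r c'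
    using span.ceq_sym[OF cyc.zeq_cyc[of cs n r c' "lact V b x"]] assms by (simp add: M.lact_mult)
qed

text \<open>Relations away from the last letter are only shifted. The tensor sign before the last
  letter needs left linearity of the coaction, the one before \<open>x\<close> its right linearity
  through \<open>\<xi>\<close>, and the cyclic relation the Takeuchi property.\<close>

lemma multibalanced_rotate:
  "multibalanced fscale (rspan (cyclic_tensor C X n)) C X n rotate_word"
  unfolding multibalanced_def
proof (intro conjI allI impI)
  fix as bs :: "'c list" and x assume len: "length as + length bs = n"
  show "cyc.zlinear (scale C) n (\<lambda>c. rotate_word (as @ c # bs, x))"
  proof (cases bs rule: rev_cases)
    case Nil
    then show ?thesis using linear_mod_coaction[OF balanced_rotate] len by simp
  next
    case (snoc bs' d)
    then show ?thesis using cyc.zlinear_slot[of "c' # as" bs' for c'] len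
      by (auto intro!: span.linear_mod_linext2)
  qed
next
  fix cs :: "'c list" assume len: "length cs = n + 1"
  then obtain as c where cs: "cs = as @ [c]" by (metis Suc_eq_plus1 length_Suc_conv_rev)
  have "cyc.zlinear (scale X) n (\<lambda>x. monom (c' # as, x))" for c'
    using cyc.zlinear_last cs len by simp
  from linear_mod_comp[OF this, unfolded bimod_along_simps, OF M.lact_linear]
  show "cyc.zlinear (scale X) n (\<lambda>x. rotate_word (cs, x))"
    using cs by (auto intro!: span.linear_mod_linext2)
next
  fix as bs :: "'c list" and c r c' x assume len: "length as + length bs + 1 = n"
  show "cyc.zeq n (rotate_word (as @ ract C c r # c' # bs, x)) (rotate_word (as @ c # lact C r c' # bs, x))"
  proof (cases bs rule: rev_cases)
    case Nil
    have "cyc.zeq n (fext (\<lambda>(b, c''). monom (c'' # as @ [ract C c r], lact V b x)) (Rh c'))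
        (fext (\<lambda>(b, c''). monom (c'' # as @ [c], lact X r (lact V b x))) (Rh c'))"
      using cyc.zeq_last[of "c'' # as" for c''] len Nil by (intro span.ceq_linext2) simp
    also have "\<dots> = fext (\<lambda>(b, c''). monom (c'' # as @ [c], lact V (\<xi> r * b) x)) (Rh c')"
      by (simp add: M.lact_mult)
    also have "cyc.zeq n \<dots> (fext (\<lambda>(b, c''). monom (c'' # as @ [c], lact V b x)) (Rh (lact C r c')))"
      using len Nil by (intro span.ceq_sym[OF ceq_coaction_lact] balanced_rotate) simp
    finally show ?thesis using Nil by simp
  next
    case (snoc bs' d)
    then show ?thesis using cyc.zeq_mid[of "c'' # as" bs' for c''] len
      by (auto intro!: span.ceq_linext2)
  qed
next
  fix as :: "'c list" and c r x assume len: "length as = n"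
  show "cyc.zeq n (rotate_word (as @ [ract C c r], x)) (rotate_word (as @ [c], lact X r x))"
    using ceq_coaction_ract[OF balanced_rotate[OF len]] by (simp add: M.lact_mult)
next
  fix c r and cs :: "'c list" and x assume len: "length cs = n"
  show "cyc.zeq n (rotate_word (lact C r c # cs, x)) (rotate_word (c # cs, ract X x r))"
  proof (cases cs rule: rev_cases)
    case Nil
    \<comment> \<open>In degree 0 the only letter is both first and last, so left linearity of the
      coaction comes in before the Takeuchi property.\<close>
    have *: "balanced fscale (rspan (cyclic_tensor C X n)) Bm C (\<lambda>b c'. monom ([c'], lact V b x))"
      using balanced_rotate[of "[]" n x] len Nil by simp
    have "cyc.zeq n (fext (\<lambda>(b, c'). monom ([c'], lact V b x)) (Rh (lact C r c)))
        (fext (\<lambda>(b, c'). monom ([c'], lact V (\<xi> r * b) x)) (Rh c))"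
      by (rule ceq_coaction_lact[OF *])
    also have "\<dots> = fext (\<lambda>(b, c'). monom ([c'], lact X r (lact V b x))) (Rh c)"
      by (simp add: M.lact_mult)
    also have "cyc.zeq n \<dots> (fext (\<lambda>(b, c'). monom ([ract C c' r], lact V b x)) (Rh c))"
      using span.ceq_sym[OF cyc.zeq_last[of "[]" n]] len Nil by (intro span.ceq_linext2) simp
    also have "cyc.zeq n \<dots> (fext (\<lambda>(b, c'). monom ([c'], lact V (b * \<zeta> r) x)) (Rh c))"
      by (rule span.ceq_sym[OF ceq_coaction_takeuchi[OF *]])
    finally show ?thesis using Nil rotate_word_snoc[of "[]"] by (simp add: M.lact_mult)
  next
    case (snoc cs' d)
    have "cyc.zeq n (fext (\<lambda>(b, c'). monom (c' # lact C r c # cs', lact V b x)) (Rh d))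
        (fext (\<lambda>(b, c'). monom (ract C c' r # c # cs', lact V b x)) (Rh d))"
      using span.ceq_sym[OF cyc.zeq_mid[of "[]" cs' n]] len snoc by (intro span.ceq_linext2) simp
    also have "cyc.zeq n \<dots> (fext (\<lambda>(b, c'). monom (c' # c # cs', lact V (b * \<zeta> r) x)) (Rh d))"
      using len snoc by (intro span.ceq_sym[OF ceq_coaction_takeuchi] balanced_rotate) simp
    finally show ?thesis using snoc by (simp add: M.lact_mult)
  qed
qed

definition rotate_map where
  "rotate_map n z = psum (cyclic_tensor C X n) z (\<lambda>w. coset (cyclic_tensor C X n) (rotate_word w))"

lemma induces_rotate: "induces (cyclic_tensor C X n) (cyclic_tensor C X n) (rotate_map n) rotate_word"
  unfolding rotate_map_def[abs_def]
  by (rule induces_psum[OF multibalanced_descends[OF multibalanced_rotate]])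

lemma rotate_map_gen:
  "rotate_map n (gen (cyclic_tensor C X n) (cs @ [c], x)) =
     psum (cyclic_tensor C X n) (\<rho> c) (\<lambda>(b, c'). gen (cyclic_tensor C X n) (c' # cs, lact V b x))"
  using induces_rotate by (simp add: induces_def gen_def psum_rep2)

lemma keys_rotate:
  assumes "w \<in> gens (cyclic_tensor C X n)"
  shows "Poly_Mapping.keys (rotate_word w) \<subseteq> gens (cyclic_tensor C X n)"
proof (cases w)
  case (Pair cs x)
  have "Poly_Mapping.keys (fext (\<lambda>(b, c'). monom (c' # butlast cs, lact V b x)) (Rh (last cs)))
      \<subseteq> gens (cyclic_tensor C X n)"
    using assms Pair by (intro cyc.keys_fext_monom2) auto
  then show ?thesis by (simp add: Pair rotate_word_def)
qed

text \<open>The counit of the rotated letter hits the old first letter. The cyclic relation moves it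
  to \<open>x\<close> as \<open>\<zeta> (\<epsilon>C c')\<close>, and \<open>comodule_counit\<close>
  turns the sum into the action of \<open>\<xi> (\<epsilon>C c)\<close>, which is the last
  face.\<close>

lemma face_0_rotate:
  assumes "length cs = n" "1 \<le> n"
  shows "cyc.zeq (n - 1) (fext (cyc.face 0) (rotate_word (cs @ [c], x))) (cyc.face n (cs @ [c], x))"
proof -
  obtain d ds where cs: "cs = d # ds" using assms by (cases cs) auto
  have lin: "cyc.zlinear (scale X) (n - 1) (\<lambda>x. monom (cs, x))" using cyc.zlinear_last assms by simp
  have "fext (cyc.face 0) (rotate_word (cs @ [c], x)) =
      fext (\<lambda>(b, c'). monom (lact C (\<epsilon>C c') d # ds, lact V b x)) (Rh c)"
    using cyc.face_split[of "[]" 0] cs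
    by (simp add: free.linext_fext case_prod_unfold del: rotate_word_snoc_Cons
        flip: append_Cons)
  also have "cyc.zeq (n - 1) \<dots> (fext (\<lambda>(b, c'). monom (cs, ract X (lact V b x) (\<epsilon>C c'))) (Rh c))"
    using cyc.zeq_cyc[of ds "n - 1"] cs assms by (intro span.ceq_linext2) auto
  also have "\<dots> = fext (\<lambda>(b, c'). monom (cs, lact V (\<zeta> (\<epsilon>C c') * b) x)) (Rh c)"
    by (simp add: M.lact_mult)
  also have "cyc.zeq (n - 1) \<dots> (monom (cs, lact V (linext sB (\<lambda>(b, c'). \<zeta> (\<epsilon>C c') * b) (Rh c)) x))"
    by (rule span.ceq_linext_map2[OF linear_mod_comp[OF lin, unfolded bimod_along_simps, OF k_linear_mult_lact]])
  finally show ?thesis using cyc.face_split[of cs n c "[]" x] assms by (simp add: comodule_counit_rep)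
qed

text \<open>Rotation interferes only when the deleted letter stands next to \<open>c\<close>: then
  \<open>\<epsilon>C d\<close> acts on \<open>x\<close> after rotating but on \<open>c\<close>
  before, and left linearity of the coaction reconciles the two.\<close>

lemma face_rotate:
  assumes "length cs = n" "1 \<le> k" "k \<le> n"
  shows "cyc.zeq (n - 1) (fext (cyc.face k) (rotate_word (cs @ [c], x)))
    (rotate_word (face_word C \<epsilon>C X (k - 1) (cs @ [c], x)))"
proof -
  have "k - 1 < length cs" using assms by simp
  then obtain as d bs where cs: "cs = as @ d # bs" and k: "length as = k - 1" by (rule split_nth)
  have 1: "fext (cyc.face k) (rotate_word (cs @ [c], x)) =
      fext (\<lambda>(b, c'). monom (act_tail C X (c' # as) (\<epsilon>C d) bs (lact V b x))) (Rh c)"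
    using cyc.face_split[of "c' # as" k for c'] cs k assms
    by (simp add: free.linext_fext case_prod_unfold)
  have 2: "face_word C \<epsilon>C X (k - 1) (cs @ [c], x) = act_tail C X as (\<epsilon>C d) (bs @ [c]) x"
    using cyc.face_split[OF k] cs by simp
  show ?thesis
  proof (cases bs)
    case Nil
    then have "length as = n - 1" using cs assms by simp
    then show ?thesis
      using span.ceq_sym[OF ceq_coaction_lact[OF balanced_rotate[of as "n - 1" x], of "\<epsilon>C d" c]] Nil
      unfolding 1 2 by (simp add: M.lact_mult)
  next
    case (Cons e es)
    then show ?thesis unfolding 1 2 by simp
  qed
qed

text \<open>This is \<open>transp_comult\<close> with the block \<open>cs\<close> standing between
  the two new letters and \<open>x\<close>. Of the two rotations on the right, the first carries
  \<open>c2\<close> past \<open>x\<close> and the second \<open>c1\<close>.\<close>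

lemma degen_0_rotate:
  assumes "length cs = n"
  shows "cyc.zeq (n + 1) (fext (degen_word \<Delta>C 0) (rotate_word (cs @ [c], x)))
    (fext rotate_word (fext rotate_word (degen_word \<Delta>C n (cs @ [c], x))))"
proof -
  have b: "balanced fscale (rspan (cyclic_tensor C X (n + 1))) C C (\<lambda>c1 c2. monom (c1 # c2 # cs, x))" for x
    using cyc.balanced_Z(1)[of "[]" cs] assms by simp
  \<comment> \<open>The balance between \<open>X\<close> and the new first letter again comes from
    the cyclic relation.\<close>
  have r: "balanced fscale (rspan (cyclic_tensor C X (n + 1))) X C (\<lambda>x c1. monom (c1 # c2 # cs, x))" for c2
  proof (rule balancedI)
    show "cyc.zlinear (scale X) (n + 1) (\<lambda>x. monom (c1 # c2 # cs, x))" for c1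
      using cyc.zlinear_last assms by simp
    show "cyc.zlinear (scale C) (n + 1) (\<lambda>c1. monom (c1 # c2 # cs, x))" for x
      by (rule balancedD(1)[OF b])
    show "cyc.zeq (n + 1) (monom (c1 # c2 # cs, ract X x r)) (monom (lact C r c1 # c2 # cs, x))" for x r c1
      by (rule span.ceq_sym, rule cyc.zeq_cyc) (simp add: assms)
  qed
  have "fext (degen_word \<Delta>C 0) (rotate_word (cs @ [c], x)) =
      fext (\<lambda>(b, c'). fext (\<lambda>(c1, c2). monom (c1 # c2 # cs, lact V b x)) (C.D c')) (Rh c)"
    using cyc.degen_split[of "[]" 0] by (simp add: free.linext_fext case_prod_unfold)
  also have "cyc.zeq (n + 1) \<dots> (fext (\<lambda>(c1, c2). fext (\<lambda>(b2, c2'). fext (\<lambda>(b1, c1').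
      monom (c1' # c2' # cs, lact V b1 (lact V b2 x))) (Rh c1)) (Rh c2)) (C.D c))"
    using r b by (rule transp_comult[where f = "\<lambda>x c1 c2. monom (c1 # c2 # cs, x)"])
  also have "\<dots> = fext rotate_word (fext rotate_word (degen_word \<Delta>C n (cs @ [c], x)))"
    using cyc.degen_split[of cs n c "[]"] assms
    by (simp add: free.linext_fext case_prod_unfold)
  finally show ?thesis .
qed

text \<open>The coaction of \<open>c\<close> and the comultiplication of \<open>d\<close> concern
  different letters, so only the order of summation changes.\<close>

lemma degen_rotate:
  assumes "length cs = n" "1 \<le> k" "k \<le> n"
  shows "fext (degen_word \<Delta>C k) (rotate_word (cs @ [c], x)) =
    fext rotate_word (degen_word \<Delta>C (k - 1) (cs @ [c], x))"
proof -
  have "k - 1 < length cs" using assms by simp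
  then obtain as d bs where cs: "cs = as @ d # bs" and k: "length as = k - 1" by (rule split_nth)
  have "fext (degen_word \<Delta>C k) (rotate_word (cs @ [c], x)) =
      fext (\<lambda>(b, c'). fext (\<lambda>(d1, d2). monom (c' # as @ d1 # d2 # bs, lact V b x)) (C.D d)) (Rh c)"
    using cyc.degen_split[of "c' # as" k for c'] cs k assms
    by (simp add: free.linext_fext case_prod_unfold)
  also have "\<dots> = fext (\<lambda>(d1, d2). fext (\<lambda>(b, c'). monom (c' # as @ d1 # d2 # bs, lact V b x)) (Rh c)) (C.D d)"
    unfolding case_prod_unfold by (rule free.linext_swap)
  also have "\<dots> = fext rotate_word (degen_word \<Delta>C (k - 1) (cs @ [c], x))"
    using cyc.degen_split[OF k] cs rotate_word_snoc[of "as @ d1 # d2 # bs" for d1 d2]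
    by (simp add: free.linext_fext case_prod_unfold)
  finally show ?thesis .
qed

lemma word_cases:
  assumes "w \<in> gens (cyclic_tensor C X n)"
  obtains cs c x where "w = (cs @ [c], x)" "length cs = n"
  using assms that by (cases w) (auto simp: length_Suc_conv_rev)

theorem para_cyclic_rotate:
  "para_cyclic_structure (cyclic_tensor C X) (Z_face C \<epsilon>C X) (Z_degen C \<Delta>C X) rotate_map"
  unfolding para_cyclic_structure_def
proof (intro conjI allI ballI impI)
  show "phom (cyclic_tensor C X n) (cyclic_tensor C X n) (rotate_map n)" for n
    using induces_rotate keys_rotate by (rule phom_induces)
next
  fix n z assume n: "1 \<le> (n::nat)" and z: "z \<in> pcarrier (cyclic_tensor C X n)"
  show "Z_face C \<epsilon>C X n 0 (rotate_map n z) = Z_face C \<epsilon>C X n n z"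
  proof (rule induces_eq[OF induces_comp[OF induces_rotate cyc.induces_face] cyc.induces_face _ z])
    show "cyc.zeq (n - 1) (fext (cyc.face 0) (rotate_word w)) (cyc.face n w)"
      if "w \<in> gens (cyclic_tensor C X n)" for w
      using word_cases[OF that] face_0_rotate n by metis
  qed (use n in auto)
next
  fix n k z assume n: "1 \<le> (n::nat)" and k: "k \<in> {1..n}" and z: "z \<in> pcarrier (cyclic_tensor C X n)"
  have 1: "induces (cyclic_tensor C X n) (cyclic_tensor C X (n - 1))
      (\<lambda>z. rotate_map (n - 1) (Z_face C \<epsilon>C X n (k - 1) z)) (\<lambda>w. rotate_word (face_word C \<epsilon>C X (k - 1) w))"
    using induces_comp[OF cyc.induces_face[of n "k - 1"] induces_rotate] n k by force
  show "Z_face C \<epsilon>C X n k (rotate_map n z) = rotate_map (n - 1) (Z_face C \<epsilon>C X n (k - 1) z)"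
  proof (rule induces_eq[OF induces_comp[OF induces_rotate cyc.induces_face] 1 _ z])
    show "cyc.zeq (n - 1) (fext (cyc.face k) (rotate_word w)) (rotate_word (face_word C \<epsilon>C X (k - 1) w))"
      if "w \<in> gens (cyclic_tensor C X n)" for w
      using word_cases[OF that] face_rotate k by (metis atLeastAtMost_iff)
  qed (use n k in auto)
next
  fix n z assume z: "z \<in> pcarrier (cyclic_tensor C X n)"
  show "Z_degen C \<Delta>C X n 0 (rotate_map n z) = rotate_map (n + 1) (rotate_map (n + 1) (Z_degen C \<Delta>C X n n z))"
  proof (rule induces_eq[OF induces_comp[OF induces_rotate cyc.induces_degen]
        induces_comp[OF induces_comp[OF cyc.induces_degen induces_rotate] induces_rotate] _ z])
    show "cyc.zeq (n + 1) (fext (degen_word \<Delta>C 0) (rotate_word w))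
        (fext rotate_word (fext rotate_word (degen_word \<Delta>C n w)))"
      if "w \<in> gens (cyclic_tensor C X n)" for w
      using word_cases[OF that] degen_0_rotate by metis
  qed auto
next
  fix n k z assume k: "k \<in> {1..n}" and z: "z \<in> pcarrier (cyclic_tensor C X n)"
  show "Z_degen C \<Delta>C X n k (rotate_map n z) = rotate_map (n + 1) (Z_degen C \<Delta>C X n (k - 1) z)"
  proof (rule induces_eq[OF induces_comp[OF induces_rotate cyc.induces_degen]
        induces_comp[OF cyc.induces_degen induces_rotate] _ z])
    show "cyc.zeq (n + 1) (fext (degen_word \<Delta>C k) (rotate_word w)) (fext rotate_word (degen_word \<Delta>C (k - 1) w))"
      if "w \<in> gens (cyclic_tensor C X n)" for w
      using word_cases[OF that] degen_rotate k by (metis atLeastAtMost_iff span.ceq_refl)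
  qed (use k in auto)
qed

end

theorem theorem2p9:
  fixes sR :: "'k::{comm_ring, comm_monoid_mult} \<Rightarrow> 'r::{ring, monoid_mult} \<Rightarrow> 'r"
    and sB :: "'k \<Rightarrow> 'b::{ring, monoid_mult} \<Rightarrow> 'b"
    and \<xi> \<zeta> :: "'r \<Rightarrow> 'b"
    and \<Delta> :: "'b \<Rightarrow> ('b \<times> 'b \<Rightarrow>\<^sub>0 'k) set"
    and \<epsilon> :: "'b \<Rightarrow> 'r"
    and C :: "('k, 'r, 'c::ab_group_add) bimod"
    and \<Delta>C :: "'c \<Rightarrow> ('c \<times> 'c \<Rightarrow>\<^sub>0 'k) set"
    and \<epsilon>C :: "'c \<Rightarrow> 'r"
    and \<rho> :: "'c \<Rightarrow> ('b \<times> 'c \<Rightarrow>\<^sub>0 'k) set"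
    and V :: "('k, 'b, 'x::ab_group_add) lmod"
    and X :: "('k, 'r, 'x) bimod"
  assumes "k_algebra sR"
    and "left_bialgebroid sR sB \<xi> \<zeta> \<Delta> \<epsilon>"
    and "left_comodule_coring sR sB \<xi> \<zeta> \<Delta> \<epsilon> C \<Delta>C \<epsilon>C \<rho>"
    and "left_module sB V"
    and "X = bimod_along \<xi> \<zeta> V"
  shows "(\<exists>w. transposition_map C \<Delta>C \<epsilon>C X w \<and>
            (\<forall>c x. w (gen (tensor2 C X) (c, x)) =
               psum (tensor2 X C) (\<rho> c) (\<lambda>(b, c'). gen (tensor2 X C) (lact V b x, c'))))
       \<and> simplicial_module (cyclic_tensor C X) (Z_face C \<epsilon>C X) (Z_degen C \<Delta>C X)
       \<and> (\<exists>w. para_cyclic_structure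
                (cyclic_tensor C X) (Z_face C \<epsilon>C X) (Z_degen C \<Delta>C X) w \<and>
            (\<forall>n cs c x. length cs = n \<longrightarrow>
               w n (gen (cyclic_tensor C X n) (cs @ [c], x)) =
               psum (cyclic_tensor C X n) (\<rho> c) (\<lambda>(b, c').
                 gen (cyclic_tensor C X n) (c' # cs, lact V b x))))"
proof -
  interpret comodule_coring_and_module sR sB \<xi> \<zeta> \<Delta> \<epsilon> C \<Delta>C \<epsilon>C \<rho> V
    using assms(3,4) by (rule comodule_coring_and_module.intro)
  show ?thesis
    unfolding assms(5)
    using transposition_map_transp transp_map_gen cyc.simplicial_module_cyclic para_cyclic_rotate rotate_map_gen
    by (auto simp: psum_gen2 transp_def)
qed

end
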